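(* Let $z\in[0,1]^n$. The following are equivalent: (1) $z$ is weakly 2-random; (2) for every computable function $f:[0,1]^n\to\mathbb{R}$ that is differentiable almost everywhere, all partial derivatives $D_if(z)$, $1\le i\le n$, exist; (3) every computable function $f:[0,1]^n\to\mathbb{R}$ that is differentiable almost everywhere is differentiable at $z$.
   Context: "Almost everywhere" refers to Lebesgue measure on $[0,1]^n$. $z$ is weakly 2-random if there is no $\Pi^0_2$ null set containing $z$, where a $\Pi^0_2$ subset of $[0,1]^n$ is an intersection $\bigcap_i G_i$ of a uniformly effective sequence of effectively open sets $G_i$ (each $G_i$ a union of a c.e. sequence of rational open boxes, uniformly in $i$). A function $f:[0,1]^n\to\mathbb{R}$ is computable if $f(q)$ is computable uniformly in $q$ with dyadic rational coordinates and there is a computable $h:\mathbb{N}\to\mathbb{N}$ with $\|x-y\|\le2^{-h(i)}\Rightarrow|f(x)-f(y)|\le2^{-i}$. $f$ is differentiable at $z$ if there is a linear map $T$ with $\lim_{h\to0}\frac{f(z+h)-f(z)-T\cdot h}{\|h\|}=0$. *)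

theory Defs
  imports "HOL-Analysis.Analysis"
begin

section \<open>Partial recursive functions\<close>

datatype recf = Zero | Succ | Proj nat | Comp recf "recf list" | PrimRec recf recf | Mu recf

text \<open>\<open>evaluates r xs y\<close>: the partial recursive function \<open>r\<close> halts on the arguments \<open>xs\<close> with
  value \<open>y\<close>. The recursion argument of \<open>PrimRec\<close> and the search variable of \<open>Mu\<close> come first.\<close>

inductive evaluates :: "recf \<Rightarrow> nat list \<Rightarrow> nat \<Rightarrow> bool" where
  zero: "evaluates Zero xs 0"
| succ: "evaluates Succ [x] (Suc x)"
| proj: "i < length xs \<Longrightarrow> evaluates (Proj i) xs (xs ! i)"
| comp: "list_all2 (\<lambda>g y. evaluates g xs y) gs ys \<Longrightarrow> evaluates f ys v \<Longrightarrow> evaluates (Comp f gs) xs v"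
| primrec_0: "evaluates f xs v \<Longrightarrow> evaluates (PrimRec f g) (0 # xs) v"
| primrec_Suc: "evaluates (PrimRec f g) (n # xs) w \<Longrightarrow> evaluates g (n # w # xs) v
    \<Longrightarrow> evaluates (PrimRec f g) (Suc n # xs) v"
| mu: "evaluates f (n # xs) 0 \<Longrightarrow> (\<forall>m<n. \<exists>v. evaluates f (m # xs) (Suc v))
    \<Longrightarrow> evaluates (Mu f) xs n"

inductive_cases evaluates_elims:
  "evaluates Zero xs v"
  "evaluates Succ xs v"
  "evaluates (Proj i) xs v"
  "evaluates (Comp f gs) xs v"
  "evaluates (PrimRec f g) (0 # xs) v"
  "evaluates (PrimRec f g) (Suc n # xs) v"
  "evaluates (Mu f) xs v"

lemma evaluates_deterministic: "evaluates r xs v \<Longrightarrow> evaluates r xs w \<Longrightarrow> v = w"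
proof (induction arbitrary: w rule: evaluates.induct)
  case (comp xs gs ys f v)
  from comp.prems obtain ys' where
    *: "list_all2 (\<lambda>g y. evaluates g xs y) gs ys'" "evaluates f ys' w"
    by (rule evaluates_elims(4))
  have "ys = ys'"
    using comp.IH(1) *(1) by (auto simp: list_all2_conv_all_nth intro!: nth_equalityI)
  then show ?case using comp.IH(2) *(2) by simp
next
  case (primrec_Suc f g n xs w' v)
  from primrec_Suc.prems obtain u where
    "evaluates (PrimRec f g) (n # xs) u" "evaluates g (n # u # xs) w"
    by (rule evaluates_elims(6))
  then show ?case using primrec_Suc.IH by blast
next
  case (mu f n xs)
  from mu.prems have *: "evaluates f (w # xs) 0" "\<forall>m<w. \<exists>v. evaluates f (m # xs) (Suc v)"
    by (rule evaluates_elims(7), simp)+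
  show ?case
  proof (cases n w rule: linorder_cases)
    case less
    then show ?thesis using * mu.IH by (metis nat.distinct(1))
  next
    case greater
    then show ?thesis using * mu.IH by (metis nat.distinct(1))
  qed
qed (blast elim: evaluates_elims)+

definition computable :: "nat \<Rightarrow> (nat list \<Rightarrow> nat) \<Rightarrow> bool" where
  "computable k F \<longleftrightarrow> (\<exists>r. \<forall>xs. length xs = k \<longrightarrow> evaluates r xs (F xs))"

definition computable_rat :: "nat \<Rightarrow> (nat list \<Rightarrow> real) \<Rightarrow> bool" where
  "computable_rat k s \<longleftrightarrow> (\<exists>a b c. computable k a \<and> computable k b \<and> computable k c \<and>
     (\<forall>xs. length xs = k \<longrightarrow> s xs = (real (a xs) - real (b xs)) / real (Suc (c xs))))"

section \<open>The unit cube\<close>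

abbreviation cube :: "(real ^ 'n) set" where
  "cube \<equiv> cbox 0 1"

text \<open>A fixed numbering of the coordinates by the numbers below \<open>CARD('n)\<close>; the notions below do
  not depend on its choice.\<close>

abbreviation idx :: "'n::finite \<Rightarrow> nat" where
  "idx \<equiv> to_nat_on UNIV"

section \<open>Weak 2-randomness\<close>

text \<open>Effectively open means relatively open in the cube. A box with \<open>l \<ge> u\<close> in some coordinate is
  empty, so enumerating by total functions also covers finite and empty enumerations.\<close>

definition uniformly_effectively_open :: "(nat \<Rightarrow> (real ^ 'n) set) \<Rightarrow> bool" where
  "uniformly_effectively_open G \<longleftrightarrow> (\<exists>l u. computable_rat 3 l \<and> computable_rat 3 u \<and>
     (\<forall>i. G i = cube \<inter> (\<Union>k. box (\<chi> j. l [i, k, idx j]) (\<chi> j. u [i, k, idx j]))))"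

definition Pi02 :: "(real ^ 'n) set \<Rightarrow> bool" where
  "Pi02 A \<longleftrightarrow> (\<exists>G. uniformly_effectively_open G \<and> A = (\<Inter>i. G i))"

definition weakly_2_random :: "real ^ 'n \<Rightarrow> bool" where
  "weakly_2_random z \<longleftrightarrow> \<not> (\<exists>A. Pi02 A \<and> A \<in> null_sets lebesgue \<and> z \<in> A)"

section \<open>Computable functions on the cube and their derivatives\<close>

text \<open>A function on the cube is a total function of which only the values on the cube are used.\<close>

definition dyadic_point :: "nat \<Rightarrow> nat list \<Rightarrow> real ^ 'n" where
  "dyadic_point m as = (\<chi> j. real (as ! idx j) / 2 ^ m)"

definition computable_on_cube :: "(real ^ 'n \<Rightarrow> real) \<Rightarrow> bool" where
  "computable_on_cube f \<longleftrightarrow>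
     (\<exists>s. computable_rat (CARD('n) + 2) s \<and>
        (\<forall>p m as. length as = CARD('n) \<and> (\<forall>a\<in>set as. a \<le> 2 ^ m) \<longrightarrow>
           \<bar>s (p # m # as) - f (dyadic_point m as)\<bar> \<le> 1 / 2 ^ p)) \<and>
     (\<exists>h. computable 1 h \<and>
        (\<forall>i. \<forall>x\<in>cube. \<forall>y\<in>cube. norm (x - y) \<le> 1 / 2 ^ h [i] \<longrightarrow> \<bar>f x - f y\<bar> \<le> 1 / 2 ^ i))"

text \<open>At boundary points, increments are restricted to those that stay in the cube.\<close>

definition differentiable_in_cube :: "(real ^ 'n \<Rightarrow> real) \<Rightarrow> real ^ 'n \<Rightarrow> bool" where
  "differentiable_in_cube f z \<longleftrightarrow> f differentiable (at z within cube)"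

definition has_partial_deriv :: "(real ^ 'n \<Rightarrow> real) \<Rightarrow> 'n \<Rightarrow> real ^ 'n \<Rightarrow> bool" where
  "has_partial_deriv f i z \<longleftrightarrow>
     (\<exists>D. ((\<lambda>t. f (z + t *\<^sub>R axis i 1)) has_real_derivative D)
        (at 0 within {t. z + t *\<^sub>R axis i 1 \<in> cube}))"

definition ae_differentiable :: "(real ^ 'n \<Rightarrow> real) \<Rightarrow> bool" where
  "ae_differentiable f \<longleftrightarrow> (AE x in lebesgue_on cube. differentiable_in_cube f x)"

end

(*
For a computable f, the point z is not differentiable iff for some e it lies in the set A_e of
points x such that for every rational linear map T and every q there is y with
0 < |y - x| < 2^-q and |f y - f x - T (y - x)| > 2^-e |y - x|. By continuity of f each condition
is effectively open in x, uniformly in (T, q), so A_e is a Pi02 set, and it is null if f is almost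
everywhere differentiable.

Conversely, let z be in the null Pi02 set A, the intersection of the G_m. Take the dyadic cells of
level n that (enlarged) lie in the stage n approximation of G_0, ..., G_m while a larger cell does
not lie in the approximation of stage n - 1. A point of A lies in infinitely many of these cells,
and any other point is near only finitely many. Put f = sum_k t_k, where t_k is supported near the
k-th cell and, along the first coordinate, is a sawtooth of slope about 1 and period 8^-k. Off A the
tail of the series is O(|y - x|^2), so f is differentiable at almost all points. If z lies in the
k-th cell, then the second difference of f on the period [a, b] around z is at most a - b: the
earlier terms are affine on [a, b] and the later ones vanish at a, b and the midpoint. Hence the
partial derivative does not exist at z.
*)
theory Submission
  imports Defs
begin

text \<open>A Pi02 null set comes with no computable rate at which the measures of its
  approximations tend to 0, so the construction cannot make the ripples live on sets of small
  measure. It relies on local finiteness instead: apart from finitely many, every ripple keeps a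
  distance of at least one width of its own cell from a given point off \<open>A\<close>. The code
  \<open>k\<close> of a cell bounds its level, so this distance is at least
  \<open>1 / 2 ^ k\<close>, and the height \<open>1 / 8 ^ k\<close> is at most
  \<open>1 / 2 ^ k\<close> times the squared distance; this is the origin of the number 8. Distinct
  cells have distinct codes and hence distinct frequencies, so overlapping cells cannot cancel each
  other in the second difference. The cut-off in the other coordinates is constant along the
  direction of oscillation, so any one prescribed partial derivative can be destroyed. In the other
  direction all data are kept rational: the l1 norm replaces the Euclidean norm, and inequalities
  between values at grid points become decidable.\<close>

section \<open>Closure properties of computable functions\<close>

lemma computable_cong:
  assumes "\<And>xs. length xs = k \<Longrightarrow> F xs = G xs"
  shows "computable k F \<longleftrightarrow> computable k G"
  using assms unfolding computable_def by auto

lemma computable_nth: "i < k \<Longrightarrow> computable k (\<lambda>xs. xs ! i)"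
  unfolding computable_def by (metis evaluates.proj)

lemma computable_comp:
  assumes F: "computable n F" and n: "length gs = n" and gs: "\<And>g. g \<in> set gs \<Longrightarrow> computable k g"
  shows "computable k (\<lambda>xs. F (map (\<lambda>g. g xs) gs))"
proof -
  obtain r where r: "\<And>xs. length xs = n \<Longrightarrow> evaluates r xs (F xs)"
    using F unfolding computable_def by blast
  have "\<forall>g\<in>set gs. \<exists>r. \<forall>xs. length xs = k \<longrightarrow> evaluates r xs (g xs)"
    using gs unfolding computable_def by blast
  then obtain R where R: "\<And>g xs. g \<in> set gs \<Longrightarrow> length xs = k \<Longrightarrow> evaluates (R g) xs (g xs)"
    by metis
  have "evaluates (Comp r (map R gs)) xs (F (map (\<lambda>g. g xs) gs))" if "length xs = k" for xs
    by (rule evaluates.comp[OF _ r]) (use R that n in \<open>auto simp: list_all2_conv_all_nth\<close>)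
  then show ?thesis unfolding computable_def by blast
qed

lemma computable_hd: "0 < k \<Longrightarrow> computable k hd"
  using computable_cong[of k hd "\<lambda>xs. xs ! 0"] computable_nth[of 0 k]
  by (metis hd_conv_nth length_greater_0_conv)

lemma computable_nth_tl: "Suc i < k \<Longrightarrow> computable k (\<lambda>xs. tl xs ! i)"
  using computable_cong[of k "\<lambda>xs. tl xs ! i" "\<lambda>xs. xs ! Suc i"] computable_nth[of "Suc i" k]
  by (simp add: nth_tl)

lemma computable_tl:
  assumes "computable k F"
  shows "computable (Suc k) (\<lambda>xs. F (tl xs))"
proof -
  have "computable (Suc k) (\<lambda>xs. F (map (\<lambda>g. g xs) (map (\<lambda>i xs. tl xs ! i) [0..<k])))"
    by (rule computable_comp[OF assms]) (auto intro!: computable_nth_tl)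
  moreover have "map (\<lambda>g. g xs) (map (\<lambda>i xs. tl xs ! i) [0..<k]) = tl xs"
    if "length xs = Suc k" for xs :: "nat list"
    using that by (auto intro!: nth_equalityI)
  ultimately show ?thesis using computable_cong by (smt (verit, best))
qed

lemma computable_comp_Cons:
  assumes "computable (Suc k) F" "computable k N"
  shows "computable k (\<lambda>xs. F (N xs # xs))"
proof -
  have "computable k (\<lambda>xs. F (map (\<lambda>g. g xs) (N # map (\<lambda>i xs. xs ! i) [0..<k])))"
    by (rule computable_comp[OF assms(1)]) (auto intro!: computable_nth assms)
  moreover have "map (\<lambda>g. g xs) (N # map (\<lambda>i xs. xs ! i) [0..<k]) = N xs # xs"
    if "length xs = k" for xs :: "nat list"
    using that by (auto intro!: nth_equalityI)
  ultimately show ?thesis using computable_cong by (smt (verit, best))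
qed

lemma computable_0: "computable k (\<lambda>xs. 0)"
  unfolding computable_def using evaluates.zero by blast

lemma computable_Suc:
  assumes "computable k F"
  shows "computable k (\<lambda>xs. Suc (F xs))"
proof -
  have "computable 1 (\<lambda>xs. Suc (xs ! 0))"
    unfolding computable_def by (intro exI[of _ Succ]) (auto simp: length_Suc_conv evaluates.succ)
  from computable_comp[OF this, of "[F]"] assms show ?thesis by simp
qed

lemma computable_const: "computable k (\<lambda>xs. c)"
  by (induction c) (auto intro: computable_0 computable_Suc)

text \<open>The step reads its arguments by \<open>hd\<close> and \<open>tl\<close> because
  \<open>PrimRec\<close> puts the counter and the previous value in front of the parameters. All
  arithmetic and all bounded loops below go through this rule.\<close>

lemma computable_rec_nat:
  assumes F: "computable k F" and N: "computable k N"
    and G: "computable (Suc (Suc k)) (\<lambda>ys. G (hd ys) (hd (tl ys)) (tl (tl ys)))"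
  shows "computable k (\<lambda>xs. rec_nat (F xs) (\<lambda>n w. G n w xs) (N xs))"
proof -
  obtain f where f: "\<And>xs. length xs = k \<Longrightarrow> evaluates f xs (F xs)"
    using F unfolding computable_def by blast
  obtain g where g: "\<And>ys. length ys = Suc (Suc k) \<Longrightarrow> evaluates g ys (G (hd ys) (hd (tl ys)) (tl (tl ys)))"
    using G unfolding computable_def by blast
  have "evaluates (PrimRec f g) (n # xs) (rec_nat (F xs) (\<lambda>n w. G n w xs) n)" if "length xs = k" for n xs
  proof (induction n)
    case 0
    then show ?case using f that by (auto intro: evaluates.primrec_0)
  next
    case (Suc n)
    then show ?case using g[of "n # _ # xs"] that by (auto intro: evaluates.primrec_Suc)
  qed
  then have "computable (Suc k) (\<lambda>ys. rec_nat (F (tl ys)) (\<lambda>n w. G n w (tl ys)) (hd ys))"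
    unfolding computable_def by (intro exI[of _ "PrimRec f g"]) (auto simp: length_Suc_conv)
  from computable_comp_Cons[OF this N] show ?thesis by simp
qed

lemma computable_hd_tl: "1 < k \<Longrightarrow> computable k (\<lambda>xs. hd (tl xs))"
  using computable_cong[of k "\<lambda>xs. hd (tl xs)" "\<lambda>xs. xs ! 1"] computable_nth[of 1 k]
  by (simp add: hd_conv_nth nth_tl flip: length_greater_0_conv)

lemma computable_tl_tl:
  assumes "computable k F"
  shows "computable (Suc (Suc k)) (\<lambda>xs. F (tl (tl xs)))"
  using computable_tl[OF computable_tl[OF assms]] by simp

lemma computable_add:
  assumes "computable k F" "computable k G"
  shows "computable k (\<lambda>xs. F xs + G xs)"
proof -
  have "rec_nat a (\<lambda>n w. Suc w) b = a + b" for a b :: nat by (induction b) auto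
  moreover have "computable k (\<lambda>xs. rec_nat (F xs) (\<lambda>n w. Suc w) (G xs))"
    by (intro computable_rec_nat assms computable_Suc computable_hd_tl) simp
  ultimately show ?thesis by simp
qed

lemma computable_mult:
  assumes "computable k F" "computable k G"
  shows "computable k (\<lambda>xs. F xs * G xs)"
proof -
  have "rec_nat 0 (\<lambda>n w. w + a) b = a * b" for a b :: nat by (induction b) auto
  moreover have "computable k (\<lambda>xs. rec_nat 0 (\<lambda>n w. w + F xs) (G xs))"
    by (intro computable_rec_nat[where G = "\<lambda>n w xs. w + F xs"] assms computable_add
        computable_tl_tl[OF assms(1)] computable_hd_tl computable_0) simp
  ultimately show ?thesis by simp
qed

lemma computable_diff:
  assumes "computable k F" "computable k G"
  shows "computable k (\<lambda>xs. F xs - G xs)"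
proof -
  \<comment> \<open>The predecessor is a recursion that returns its counter; truncated subtraction
    iterates it.\<close>
  have pred: "rec_nat 0 (\<lambda>n w. n) a = a - 1" for a by (cases a) auto
  have dif: "rec_nat a (\<lambda>n w. w - 1) b = a - b" for a b :: nat by (induction b) auto
  have pr: "computable (Suc (Suc k)) (\<lambda>xs. rec_nat 0 (\<lambda>n w. n) (hd (tl xs)))"
    by (intro computable_rec_nat computable_hd computable_hd_tl computable_0) simp_all
  have "computable k (\<lambda>xs. rec_nat (F xs) (\<lambda>n w. w - 1) (G xs))"
    by (intro computable_rec_nat assms pr[unfolded pred])
  then show ?thesis unfolding dif .
qed

lemma computable_power:
  assumes "computable k F" "computable k G"
  shows "computable k (\<lambda>xs. F xs ^ G xs)"
proof -
  have "rec_nat 1 (\<lambda>n w. w * a) b = a ^ b" for a b :: nat by (induction b) auto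
  moreover have "computable k (\<lambda>xs. rec_nat 1 (\<lambda>n w. w * F xs) (G xs))"
    by (intro computable_rec_nat[where G = "\<lambda>n w xs. w * F xs"] assms computable_mult
        computable_tl_tl[OF assms(1)] computable_hd_tl computable_const) simp
  ultimately show ?thesis by simp
qed

text \<open>A summand or factor depends on the counter and the parameters only. This makes it usable
  in a recursion step, where the accumulated value stands between them.\<close>

lemma computable_drop_second:
  assumes G: "computable (Suc k) (\<lambda>ys. G (hd ys) (tl ys))"
  shows "computable (Suc (Suc k)) (\<lambda>ys. G (hd ys) (tl (tl ys)))"
proof -
  have "computable (Suc (Suc k)) (\<lambda>ys. (\<lambda>ys. G (hd ys) (tl ys)) (map (\<lambda>g. g ys) (hd # map (\<lambda>i xs. tl xs ! Suc i) [0..<k])))"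
    by (rule computable_comp[OF G]) (auto intro!: computable_hd computable_nth_tl)
  moreover have "map (\<lambda>g. g xs) (hd # map (\<lambda>i xs. tl xs ! Suc i) [0..<k]) = hd xs # tl (tl xs)"
    if "length xs = Suc (Suc k)" for xs :: "nat list"
    using that by (auto intro!: nth_equalityI simp: nth_tl)
  ultimately show ?thesis
    by (subst (asm) computable_cong[where G = "\<lambda>ys. G (hd ys) (tl (tl ys))"]) simp_all
qed

lemma computable_sum:
  assumes N: "computable k N" and G: "computable (Suc k) (\<lambda>ys. G (hd ys) (tl ys))"
  shows "computable k (\<lambda>xs. \<Sum>i<N xs. G i xs)"
proof -
  have eq: "rec_nat 0 (\<lambda>n w. w + g n) b = (\<Sum>i<b. g i)" for g b by (induction b) (auto)
  note computable_drop_second[OF G]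
  then have "computable k (\<lambda>xs. rec_nat 0 (\<lambda>n w. w + G n xs) (N xs))"
    by (intro computable_rec_nat[where G = "\<lambda>n w xs. w + G n xs"] N computable_add computable_0
        computable_hd_tl) simp_all
  then show ?thesis unfolding eq .
qed

lemma computable_prod:
  assumes N: "computable k N" and G: "computable (Suc k) (\<lambda>ys. G (hd ys) (tl ys))"
  shows "computable k (\<lambda>xs. \<Prod>i<N xs. G i xs)"
proof -
  have eq: "rec_nat 1 (\<lambda>n w. w * g n) b = (\<Prod>i<b. g i)" for g b by (induction b) (auto)
  note computable_drop_second[OF G]
  then have "computable k (\<lambda>xs. rec_nat 1 (\<lambda>n w. w * G n xs) (N xs))"
    by (intro computable_rec_nat[where G = "\<lambda>n w xs. w * G n xs"] N computable_mult computable_const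
        computable_hd_tl) simp_all
  then show ?thesis unfolding eq .
qed

section \<open>Decidable predicates\<close>

definition decidable :: "nat \<Rightarrow> (nat list \<Rightarrow> bool) \<Rightarrow> bool" where
  "decidable k P \<longleftrightarrow> computable k (\<lambda>xs. of_bool (P xs))"

lemma decidable_cong:
  assumes "\<And>xs. length xs = k \<Longrightarrow> P xs = Q xs"
  shows "decidable k P \<longleftrightarrow> decidable k Q"
  unfolding decidable_def by (rule computable_cong) (simp add: assms)

lemma decidable_less:
  assumes "computable k F" "computable k G"
  shows "decidable k (\<lambda>xs. F xs < G xs)"
proof -
  have "of_bool (a < b) = 1 - (1 - (b - a))" for a b :: nat by auto
  then show ?thesis unfolding decidable_def
    by (simp only:) (intro computable_diff computable_const assms)
qed

lemma decidable_not:
  assumes "decidable k P"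
  shows "decidable k (\<lambda>xs. \<not> P xs)"
proof -
  have "of_bool (\<not> p) = 1 - (of_bool p :: nat)" for p by auto
  then show ?thesis unfolding decidable_def
    by (simp only:) (intro computable_diff computable_const assms[unfolded decidable_def])
qed

lemma decidable_conj:
  assumes "decidable k P" "decidable k Q"
  shows "decidable k (\<lambda>xs. P xs \<and> Q xs)"
proof -
  have "of_bool (p \<and> q) = of_bool p * (of_bool q :: nat)" for p q by auto
  then show ?thesis unfolding decidable_def
    by (simp only:) (intro computable_mult assms[unfolded decidable_def])
qed

lemma decidable_le:
  assumes "computable k F" "computable k G"
  shows "decidable k (\<lambda>xs. F xs \<le> G xs)"
  using decidable_not[OF decidable_less[OF assms(2,1)]] by (simp add: not_less)

lemma decidable_Bex_less:
  assumes "computable k N" "decidable (Suc k) (\<lambda>ys. P (hd ys) (tl ys))"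
  shows "decidable k (\<lambda>xs. \<exists>i<N xs. P i xs)"
proof -
  have "(\<exists>i<n. p i) \<longleftrightarrow> 0 < (\<Sum>i<n. of_bool (p i) :: nat)" for n :: nat and p
    unfolding zero_less_iff_neq_zero by (subst sum_eq_0_iff) auto
  then show ?thesis
    by (simp only:) (intro decidable_less computable_sum computable_const
        assms[unfolded decidable_def])
qed

lemma decidable_Ball_less:
  assumes "computable k N" "decidable (Suc k) (\<lambda>ys. P (hd ys) (tl ys))"
  shows "decidable k (\<lambda>xs. \<forall>i<N xs. P i xs)"
  using decidable_not[OF decidable_Bex_less[OF assms(1) decidable_not[OF assms(2)]]] by simp

lemma decidable_Ball_finite:
  assumes "finite J" "\<And>j. j \<in> J \<Longrightarrow> decidable k (P j)"
  shows "decidable k (\<lambda>xs. \<forall>j\<in>J. P j xs)"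
  using assms
proof (induction J)
  case empty
  show ?case unfolding decidable_def by (simp add: computable_const)
next
  case (insert j J)
  then show ?case by (simp add: decidable_conj)
qed

lemma computable_if:
  assumes "decidable k P" "computable k F" "computable k G"
  shows "computable k (\<lambda>xs. if P xs then F xs else G xs)"
proof -
  have "(if p then a else b) = of_bool p * a + (1 - of_bool p) * b" for p and a b :: nat by auto
  then show ?thesis
    by (simp only:) (intro computable_add computable_mult computable_diff computable_const assms
        assms(1)[unfolded decidable_def])
qed

text \<open>The quotient is the number of positive multiples of the divisor that do not exceed the
  dividend. The multipliers do not exceed the dividend either, so a bounded sum counts them.\<close>

lemma computable_div_Suc:
  assumes F: "computable k F" and G: "computable k G"
  shows "computable k (\<lambda>xs. F xs div Suc (G xs))"
proof -
  have "a div Suc b = (\<Sum>i<a. of_bool (Suc i * Suc b \<le> a))" for a b :: nat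
  proof -
    have "{..<a} \<inter> {i. Suc i * Suc b \<le> a} = {..<a div Suc b}"
    proof (intro equalityI subsetI)
      fix i assume "i \<in> {..<a div Suc b}"
      then have *: "Suc i * Suc b \<le> a" by (simp add: less_eq_div_iff_mult_less_eq Suc_le_eq flip: Suc_le_eq)
      have "Suc i \<le> Suc i * Suc b" by simp
      with * show "i \<in> {..<a} \<inter> {i. Suc i * Suc b \<le> a}" by simp
    qed (simp add: less_eq_div_iff_mult_less_eq flip: Suc_le_eq)
    then show ?thesis by (simp only: sum_of_bool_eq finite_lessThan card_lessThan of_nat_id)
  qed
  moreover have "computable k (\<lambda>xs. \<Sum>i<F xs. of_bool (Suc i * Suc (G xs) \<le> F xs))"
    by (intro computable_sum F decidable_le[unfolded decidable_def] computable_mult computable_Suc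
        computable_hd computable_tl[OF F] computable_tl[OF G]) simp
  ultimately show ?thesis by simp
qed

lemmas computable_intros = computable_nth computable_hd computable_nth_tl computable_hd_tl
  computable_const computable_Suc computable_add computable_mult computable_diff computable_power
  computable_sum computable_prod computable_if computable_div_Suc
  decidable_less decidable_le decidable_not decidable_conj decidable_Bex_less decidable_Ball_less

section \<open>Coding of finite sequences\<close>

text \<open>A surjection of the natural numbers onto pairs: \<open>(x, y)\<close> is hit at \<open>(x + y)\<^sup>2 + x\<close>.\<close>

definition isqrt :: "nat \<Rightarrow> nat" where
  "isqrt k = (\<Sum>i<k. of_bool ((Suc i)\<^sup>2 \<le> k))"

definition unpair1 :: "nat \<Rightarrow> nat" where "unpair1 k = k - (isqrt k)\<^sup>2"
definition unpair2 :: "nat \<Rightarrow> nat" where "unpair2 k = isqrt k - unpair1 k"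
text \<open>A number is read as an infinite list with head \<open>unpair1\<close> and rest
  \<open>unpair2\<close>. No length is stored; each use reads as many entries as it wants.\<close>

definition digit :: "nat \<Rightarrow> nat \<Rightarrow> nat" where "digit j k = unpair1 ((unpair2 ^^ j) k)"

lemma isqrt_le: "isqrt k \<le> k"
  unfolding isqrt_def by (rule order.trans[OF sum_mono[where g = "\<lambda>_. 1"]]) auto

text \<open>The bound on \<open>x\<close> keeps \<open>s\<^sup>2 + x\<close> below the next
  square.\<close>

lemma isqrt_eq:
  assumes "x \<le> 2 * s"
  shows "isqrt (s\<^sup>2 + x) = s"
proof -
  have "{..<s\<^sup>2 + x} \<inter> {i. (Suc i)\<^sup>2 \<le> s\<^sup>2 + x} = {..<s}"
  proof (intro equalityI subsetI)
    fix i assume "i \<in> {..<s\<^sup>2 + x} \<inter> {i. (Suc i)\<^sup>2 \<le> s\<^sup>2 + x}"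
    then have "(Suc i)\<^sup>2 \<le> s\<^sup>2 + 2 * s" using assms by simp
    also have "\<dots> < (Suc s)\<^sup>2" by (simp add: power2_eq_square)
    finally show "i \<in> {..<s}" using power_less_imp_less_base by fastforce
  next
    fix i assume "i \<in> {..<s}"
    then have "Suc i \<le> s" by simp
    then have "(Suc i)\<^sup>2 \<le> s\<^sup>2" by (rule power_mono) simp
    moreover have "i < (Suc i)\<^sup>2" by (simp add: power2_eq_square)
    ultimately have "i < s\<^sup>2 + x" "(Suc i)\<^sup>2 \<le> s\<^sup>2 + x" by linarith+
    then show "i \<in> {..<s\<^sup>2 + x} \<inter> {i. (Suc i)\<^sup>2 \<le> s\<^sup>2 + x}" by simp
  qed
  then show ?thesis unfolding isqrt_def by (simp only: sum_of_bool_eq finite_lessThan card_lessThan of_nat_id)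
qed

lemma unpair_surj: "\<exists>k. unpair1 k = x \<and> unpair2 k = y"
  using isqrt_eq[of x "x + y"] by (intro exI[of _ "(x + y)\<^sup>2 + x"]) (simp add: unpair1_def unpair2_def)

lemma digit_0: "digit 0 k = unpair1 k" and digit_Suc: "digit (Suc j) k = digit j (unpair2 k)"
  by (simp_all add: digit_def funpow_Suc_right del: funpow.simps(2))

lemma digit_surj: "\<exists>k. (\<forall>j<d. digit j k = b j) \<and> (unpair2 ^^ d) k = 0"
proof (induction d arbitrary: b)
  case (Suc d)
  obtain k' where "\<forall>j<d. digit j k' = b (Suc j)" "(unpair2 ^^ d) k' = 0"
    using Suc[of "\<lambda>j. b (Suc j)"] by blast
  moreover obtain k where "unpair1 k = b 0" "unpair2 k = k'" using unpair_surj by blast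
  ultimately have "digit j k = b j" if "j < Suc d" for j
    using that by (cases j) (simp_all add: digit_0 digit_Suc)
  moreover have "(unpair2 ^^ Suc d) k = 0"
    using \<open>unpair2 k = k'\<close> \<open>(unpair2 ^^ d) k' = 0\<close> by (simp add: funpow_Suc_right del: funpow.simps)
  ultimately show ?case by blast
qed simp

lemma unpair2_funpow_le: "(unpair2 ^^ j) k \<le> k"
proof (induction j)
  case (Suc j)
  then show ?case using isqrt_le[of "(unpair2 ^^ j) k"] by (simp add: unpair2_def[of "(unpair2 ^^ j) k"])
qed simp

text \<open>This ties the geometry of a cell to its code: the layer and the level of cell
  \<open>k\<close> are at most \<open>k\<close>.\<close>

lemma digit_le: "digit j k \<le> k"
  unfolding digit_def unpair1_def using unpair2_funpow_le[of j k] by simp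

text \<open>Without the condition on the remainder there would be infinitely many codes of the same
  digits.\<close>

lemma finite_bounded_digits:
  "finite {k. (\<forall>j<D. digit j k \<le> B) \<and> (unpair2 ^^ D) k = 0}"
proof -
  \<comment> \<open>A number is bounded in terms of its two components, and so, by induction, in
    terms of its digits and the last remainder.\<close>
  have bound: "k \<le> (unpair1 k + unpair2 k)\<^sup>2 + unpair1 k" for k
  proof -
    have "isqrt k \<le> unpair1 k + unpair2 k" by (simp add: unpair2_def)
    then have "(isqrt k)\<^sup>2 \<le> (unpair1 k + unpair2 k)\<^sup>2" by (rule power_mono) simp
    moreover have "k \<le> (isqrt k)\<^sup>2 + unpair1 k" by (simp add: unpair1_def)
    ultimately show ?thesis by linarith
  qed
  have "\<exists>C. \<forall>k. (\<forall>j<D. digit j k \<le> B) \<and> (unpair2 ^^ D) k = 0 \<longrightarrow> k \<le> C"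
  proof (induction D)
    case (Suc D)
    then obtain C where C: "\<And>k. (\<forall>j<D. digit j k \<le> B) \<and> (unpair2 ^^ D) k = 0 \<Longrightarrow> k \<le> C" by blast
    have "k \<le> (B + C)\<^sup>2 + B" if k: "(\<forall>j<Suc D. digit j k \<le> B) \<and> (unpair2 ^^ Suc D) k = 0" for k
    proof -
      have "unpair2 k \<le> C"
        using k by (intro C) (auto simp: digit_Suc[symmetric] funpow_Suc_right simp del: funpow.simps)
      moreover have "unpair1 k \<le> B" using k digit_0 by (metis zero_less_Suc)
      ultimately have "(unpair1 k + unpair2 k)\<^sup>2 \<le> (B + C)\<^sup>2" by (intro power_mono) auto
      then show ?thesis using bound[of k] \<open>unpair1 k \<le> B\<close> by linarith
    qed
    then show ?case by blast
  qed auto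
  then obtain C where "{k. (\<forall>j<D. digit j k \<le> B) \<and> (unpair2 ^^ D) k = 0} \<subseteq> {..C}" by auto
  then show ?thesis by (rule finite_subset) simp
qed

lemma computable_isqrt:
  assumes "computable k F"
  shows "computable k (\<lambda>xs. isqrt (F xs))"
  unfolding isqrt_def
  by (intro computable_intros assms computable_tl[OF assms] decidable_le[unfolded decidable_def]) simp

lemma computable_unpair:
  assumes "computable k F"
  shows "computable k (\<lambda>xs. unpair1 (F xs))" "computable k (\<lambda>xs. unpair2 (F xs))"
  unfolding unpair1_def unpair2_def by (intro computable_intros computable_isqrt assms)+

lemma computable_digit:
  assumes F: "computable k F" and J: "computable k J"
  shows "computable k (\<lambda>xs. digit (J xs) (F xs))"
proof -
  have "(unpair2 ^^ j) a = rec_nat a (\<lambda>n w. unpair2 w) j" for j a by (induction j) auto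
  then show ?thesis unfolding digit_def
    by (simp only:) (intro computable_unpair computable_rec_nat computable_hd_tl assms, simp)
qed

section \<open>Rational-valued computable functions\<close>

lemma computable_rat_of_nat:
  assumes "computable k F"
  shows "computable_rat k (\<lambda>xs. real (F xs))"
  unfolding computable_rat_def
  by (rule exI[of _ F], rule exI[of _ "\<lambda>_. 0"], rule exI[of _ "\<lambda>_. 0"]) (simp add: assms computable_const)

lemma computable_ratE:
  assumes "computable_rat k F"
  obtains a b c where "computable k a" "computable k b" "computable k c"
    "\<And>xs. length xs = k \<Longrightarrow> F xs = (real (a xs) - real (b xs)) / real (Suc (c xs))"
  using assms unfolding computable_rat_def by blast

lemma computable_ratI:
  assumes "computable k a" "computable k b" "computable k c"
    "\<And>xs. length xs = k \<Longrightarrow> F xs = (real (a xs) - real (b xs)) / real (Suc (c xs))"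
  shows "computable_rat k F"
  using assms unfolding computable_rat_def by blast

lemma computable_rat_diff:
  assumes "computable_rat k F" "computable_rat k G"
  shows "computable_rat k (\<lambda>xs. F xs - G xs)"
proof -
  obtain a b c where F: "computable k a" "computable k b" "computable k c"
    "\<And>xs. length xs = k \<Longrightarrow> F xs = (real (a xs) - real (b xs)) / real (Suc (c xs))"
    using assms(1) by (rule computable_ratE) blast
  obtain a' b' c' where G: "computable k a'" "computable k b'" "computable k c'"
    "\<And>xs. length xs = k \<Longrightarrow> G xs = (real (a' xs) - real (b' xs)) / real (Suc (c' xs))"
    using assms(2) by (rule computable_ratE) blast
  \<comment> \<open>\<open>u * v + u + v\<close> is the predecessor of the product of the two
    denominators, so the result is again a fraction over a successor.\<close>
  have "(x - y) / real (Suc u) - (x' - y') / real (Suc v) =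
      ((x * real (Suc v) + y' * real (Suc u)) - (y * real (Suc v) + x' * real (Suc u))) / real (Suc (u * v + u + v))"
    for x y x' y' :: real and u v :: nat
  proof -
    have "real (Suc (u * v + u + v)) = real (Suc u) * real (Suc v)" by (simp add: algebra_simps)
    moreover have "(x - y) / p - (x' - y') / q = ((x * q + y' * p) - (y * q + x' * p)) / (p * q)" if "p > 0" "q > 0" for p q
      using that by (simp add: field_simps)
    ultimately show ?thesis by (simp only: of_nat_0_less_iff zero_less_Suc)
  qed
  then show ?thesis
    by (intro computable_ratI[of k "\<lambda>xs. a xs * Suc (c' xs) + b' xs * Suc (c xs)"
          "\<lambda>xs. b xs * Suc (c' xs) + a' xs * Suc (c xs)" "\<lambda>xs. c xs * c' xs + c xs + c' xs"]
        computable_intros F(1-3) G(1-3)) (simp only: F(4) G(4) of_nat_add of_nat_mult)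
qed

lemma computable_rat_mult:
  assumes "computable_rat k F" "computable_rat k G"
  shows "computable_rat k (\<lambda>xs. F xs * G xs)"
proof -
  obtain a b c where F: "computable k a" "computable k b" "computable k c"
    "\<And>xs. length xs = k \<Longrightarrow> F xs = (real (a xs) - real (b xs)) / real (Suc (c xs))"
    using assms(1) by (rule computable_ratE) blast
  obtain a' b' c' where G: "computable k a'" "computable k b'" "computable k c'"
    "\<And>xs. length xs = k \<Longrightarrow> G xs = (real (a' xs) - real (b' xs)) / real (Suc (c' xs))"
    using assms(2) by (rule computable_ratE) blast
  have "(x - y) / real (Suc u) * ((x' - y') / real (Suc v)) =
      ((x * x' + y * y') - (x * y' + y * x')) / real (Suc (u * v + u + v))"
    for x y x' y' :: real and u v :: nat
  proof -
    have "real (Suc (u * v + u + v)) = real (Suc u) * real (Suc v)" by (simp add: algebra_simps)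
    moreover have "(x - y) / p * ((x' - y') / q) = ((x * x' + y * y') - (x * y' + y * x')) / (p * q)" if "p > 0" "q > 0" for p q
      using that by (simp add: field_simps)
    ultimately show ?thesis by (simp only: of_nat_0_less_iff zero_less_Suc)
  qed
  then show ?thesis
    by (intro computable_ratI[of k "\<lambda>xs. a xs * a' xs + b xs * b' xs"
          "\<lambda>xs. a xs * b' xs + b xs * a' xs" "\<lambda>xs. c xs * c' xs + c xs + c' xs"]
        computable_intros F(1-3) G(1-3)) (simp only: F(4) G(4) of_nat_add of_nat_mult)
qed

lemma computable_rat_const_nat: "computable_rat k (\<lambda>xs. real c)"
  by (intro computable_rat_of_nat computable_const)

lemma computable_rat_0: "computable_rat k (\<lambda>xs. 0)"
  using computable_rat_const_nat[of k 0] by simp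

lemma computable_rat_1: "computable_rat k (\<lambda>xs. 1)"
  using computable_rat_const_nat[of k 1] by simp

lemma computable_rat_numeral: "computable_rat k (\<lambda>xs. numeral c)"
  using computable_rat_const_nat[of k "numeral c"] by simp

lemma computable_rat_uminus:
  assumes "computable_rat k F"
  shows "computable_rat k (\<lambda>xs. - F xs)"
  using computable_rat_diff[OF computable_rat_0 assms] by simp

lemma computable_rat_add:
  assumes "computable_rat k F" "computable_rat k G"
  shows "computable_rat k (\<lambda>xs. F xs + G xs)"
  using computable_rat_diff[OF assms(1) computable_rat_uminus[OF assms(2)]] by simp

lemma computable_rat_divide_Suc:
  assumes "computable_rat k F" "computable k N"
  shows "computable_rat k (\<lambda>xs. F xs / real (Suc (N xs)))"
proof -
  have "computable_rat k (\<lambda>xs. 1 / real (Suc (N xs)))"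
    by (rule computable_ratI[OF computable_const[of _ 1] computable_0 assms(2)]) simp
  from computable_rat_mult[OF assms(1) this] show ?thesis by simp
qed

lemma computable_rat_divide_power2:
  assumes "computable_rat k F" "computable k N"
  shows "computable_rat k (\<lambda>xs. F xs / 2 ^ N xs)"
proof -
  have "computable k (\<lambda>xs. 2 ^ N xs - 1)"
    by (intro computable_intros assms)
  from computable_rat_divide_Suc[OF assms(1) this] show ?thesis by simp
qed

lemma computable_rat_power2:
  assumes "computable k N"
  shows "computable_rat k (\<lambda>xs. 2 ^ N xs)"
  using computable_rat_of_nat[OF computable_power[OF computable_const[of _ 2] assms]] by simp

text \<open>The values are exact fractions with positive denominators, not approximations, so the
  sign can be read off the numerator. Case distinctions, \<open>min\<close>, \<open>max\<close> and
  absolute values rest on this.\<close>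

lemma decidable_rat_less:
  assumes "computable_rat k F" "computable_rat k G"
  shows "decidable k (\<lambda>xs. F xs < G xs)"
proof -
  obtain a b c where *: "computable k a" "computable k b" "computable k c"
    "\<And>xs. length xs = k \<Longrightarrow> F xs - G xs = (real (a xs) - real (b xs)) / real (Suc (c xs))"
    using computable_rat_diff[OF assms] by (rule computable_ratE) blast
  have "decidable k (\<lambda>xs. a xs < b xs)" by (intro computable_intros *)
  moreover have "F xs < G xs \<longleftrightarrow> a xs < b xs" if "length xs = k" for xs
  proof -
    have "F xs < G xs \<longleftrightarrow> F xs - G xs < 0" by simp
    also have "\<dots> \<longleftrightarrow> a xs < b xs" unfolding *(4)[OF that] by (simp add: divide_less_0_iff)
    finally show ?thesis .
  qed
  ultimately show ?thesis using decidable_cong[of k "\<lambda>xs. F xs < G xs" "\<lambda>xs. a xs < b xs"] by blast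
qed

lemma computable_rat_if:
  assumes P: "decidable k P" and "computable_rat k F" "computable_rat k G"
  shows "computable_rat k (\<lambda>xs. if P xs then F xs else G xs)"
proof -
  have "(if p then a else b) = real (of_bool p) * a + (1 - real (of_bool p)) * b" for p and a b :: real
    by auto
  then show ?thesis
    by (simp only:) (intro computable_rat_add computable_rat_mult computable_rat_diff
        computable_rat_1 assms computable_rat_of_nat P[unfolded decidable_def])
qed

lemma computable_rat_min:
  assumes "computable_rat k F" "computable_rat k G"
  shows "computable_rat k (\<lambda>xs. min (F xs) (G xs))"
proof -
  have "min a b = (if a < b then a else b)" for a b :: real by auto
  then show ?thesis by (simp only:) (intro computable_rat_if decidable_rat_less assms)
qed

lemma computable_rat_max:
  assumes "computable_rat k F" "computable_rat k G"
  shows "computable_rat k (\<lambda>xs. max (F xs) (G xs))"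
proof -
  have "max a b = (if a < b then b else a)" for a b :: real by auto
  then show ?thesis by (simp only:) (intro computable_rat_if decidable_rat_less assms)
qed

lemma computable_rat_abs:
  assumes "computable_rat k F"
  shows "computable_rat k (\<lambda>xs. \<bar>F xs\<bar>)"
proof -
  have "\<bar>a\<bar> = max a (- a)" for a :: real by auto
  then show ?thesis by (simp only:) (intro computable_rat_max computable_rat_uminus assms)
qed

lemma computable_rat_sum_finite:
  assumes "finite J" "\<And>j. j \<in> J \<Longrightarrow> computable_rat k (F j)"
  shows "computable_rat k (\<lambda>xs. \<Sum>j\<in>J. F j xs)"
  using assms by (induction J) (auto intro: computable_rat_0 computable_rat_add)

text \<open>Negative values are sent to 0 both by \<open>nat\<close> and by the truncated
  subtraction of the two parts of the numerator.\<close>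

lemma computable_nat_floor:
  assumes "computable_rat k F"
  shows "computable k (\<lambda>xs. nat \<lfloor>F xs\<rfloor>)"
proof -
  obtain a b c where *: "computable k a" "computable k b" "computable k c"
    "\<And>xs. length xs = k \<Longrightarrow> F xs = (real (a xs) - real (b xs)) / real (Suc (c xs))"
    using assms by (rule computable_ratE) blast
  have "nat \<lfloor>(real x - real y) / real (Suc z)\<rfloor> = (x - y) div Suc z" for x y z
  proof (cases "y \<le> x")
    case True
    then have "(real x - real y) / real (Suc z) = real (x - y) / real (Suc z)" by simp
    then show ?thesis by (simp only: floor_divide_of_nat_eq nat_int)
  next
    case False
    then have "(real x - real y) / real (Suc z) \<le> 0" by (simp add: divide_le_0_iff)
    then show ?thesis using False by (simp add: floor_le_iff)
  qed
  then show ?thesis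
    using computable_div_Suc[OF computable_diff[OF *(1,2)] *(3)] *(4)
    by (subst computable_cong[where G = "\<lambda>xs. (a xs - b xs) div Suc (c xs)"]) auto
qed

lemma computable_rat_sum:
  assumes N: "computable k N" and G: "computable_rat (Suc k) (\<lambda>ys. G (hd ys) (tl ys))"
  shows "computable_rat k (\<lambda>xs. \<Sum>i<N xs. G i xs)"
proof -
  obtain a b c where *: "computable (Suc k) a" "computable (Suc k) b" "computable (Suc k) c"
    "\<And>xs. length xs = Suc k \<Longrightarrow> G (hd xs) (tl xs) = (real (a xs) - real (b xs)) / real (Suc (c xs))"
    using G by (rule computable_ratE) blast
  \<comment> \<open>The number of summands depends on the input, so they are put over one
    denominator, the product of all of them.\<close>
  define P where "P xs = (\<Prod>i<N xs. Suc (c (i # xs)))" for xs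
  have hdtl: "computable (Suc k) (\<lambda>ys. q (hd ys # tl ys))" if "computable (Suc k) q" for q
    using that by (subst computable_cong[where G = q]) (auto simp: length_Suc_conv)
  have P: "computable k P"
    unfolding P_def by (intro computable_intros N hdtl *)
  have *: "(\<Sum>i<N xs. G i xs) = (real (\<Sum>i<N xs. a (i # xs) * (P xs div Suc (c (i # xs)))) -
     real (\<Sum>i<N xs. b (i # xs) * (P xs div Suc (c (i # xs))))) / real (Suc (P xs - 1))"
    if "length xs = k" for xs
  proof -
    have P0: "P xs \<noteq> 0" by (simp add: P_def)
    have "G i xs = (real (a (i # xs) * (P xs div Suc (c (i # xs)))) -
       real (b (i # xs) * (P xs div Suc (c (i # xs))))) / real (P xs)" if "i < N xs" for i
    proof -
      have "Suc (c (i # xs)) dvd P xs" unfolding P_def using that by (intro dvd_prodI) auto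
      then have "real (P xs div Suc (c (i # xs))) = real (P xs) / real (Suc (c (i # xs)))"
        by (rule real_of_nat_div)
      then have "real (x * (P xs div Suc (c (i # xs)))) / real (P xs) = real x / real (Suc (c (i # xs)))" for x
        using P0 by simp
      then show ?thesis using *(4)[of "i # xs"] \<open>length xs = k\<close>
        by (simp only: diff_divide_distrib) simp
    qed
    then show ?thesis using P0
      by (simp add: sum_subtractf diff_divide_distrib flip: sum_divide_distrib)
  qed
  show ?thesis
    by (rule computable_ratI[OF _ _ _ *])
      (intro computable_intros N hdtl \<open>computable (Suc k) a\<close> \<open>computable (Suc k) b\<close>
        \<open>computable (Suc k) c\<close> P computable_tl[OF P])+
qed

lemma computable_rat_comp:
  assumes F: "computable_rat n F" and n: "length gs = n" and gs: "\<And>g. g \<in> set gs \<Longrightarrow> computable k g"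
  shows "computable_rat k (\<lambda>xs. F (map (\<lambda>g. g xs) gs))"
proof -
  obtain a b c where *: "computable n a" "computable n b" "computable n c"
    "\<And>xs. length xs = n \<Longrightarrow> F xs = (real (a xs) - real (b xs)) / real (Suc (c xs))"
    using F by (rule computable_ratE) blast
  show ?thesis
    by (rule computable_ratI[OF computable_comp[OF *(1) n gs] computable_comp[OF *(2) n gs]
          computable_comp[OF *(3) n gs]]) (simp_all add: *(4) n)
qed

lemmas computable_rat_intros = computable_rat_0 computable_rat_1 computable_rat_numeral
  computable_rat_of_nat computable_rat_uminus computable_rat_add computable_rat_diff
  computable_rat_mult computable_rat_divide_power2 computable_rat_divide_Suc computable_rat_power2
  decidable_rat_less computable_rat_if computable_rat_min computable_rat_max computable_rat_abs
  computable_rat_sum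

section \<open>Sawtooth functions\<close>

text \<open>The distance from \<open>y\<close> to the grid of multiples of \<open>1 / 2 ^ r\<close>:
  slopes 1 and -1, period \<open>1 / 2 ^ r\<close>.\<close>

definition sawtooth :: "nat \<Rightarrow> real \<Rightarrow> real" where
  "sawtooth r y = \<bar>2 ^ r * y - of_int (round (2 ^ r * y))\<bar> / 2 ^ r"

lemma sawtooth_nonneg: "0 \<le> sawtooth r y"
  by (simp add: sawtooth_def)

lemma sawtooth_le: "sawtooth r y \<le> 1 / 2 ^ r"
  using of_int_round_abs_le[of "2 ^ r * y"] by (simp add: sawtooth_def divide_right_mono abs_minus_commute)

text \<open>The grid point nearest to \<open>y\<close> is also a candidate for \<open>x\<close>. At
  a zero \<open>y\<close> of the sawtooth this bounds it by a ramp, which is how it is compared with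
  the cut-off.\<close>

lemma sawtooth_le_add: "sawtooth r x \<le> sawtooth r y + \<bar>x - y\<bar>"
proof -
  have "\<bar>2 ^ r * x - of_int (round (2 ^ r * x))\<bar> \<le> \<bar>2 ^ r * x - of_int (round (2 ^ r * y))\<bar>"
    by (rule round_diff_minimal)
  also have "\<dots> \<le> \<bar>2 ^ r * y - of_int (round (2 ^ r * y))\<bar> + 2 ^ r * \<bar>x - y\<bar>"
  proof -
    have "2 ^ r * \<bar>x - y\<bar> = \<bar>2 ^ r * x - 2 ^ r * y\<bar>" by (simp add: abs_mult flip: right_diff_distrib)
    then show ?thesis by linarith
  qed
  finally show ?thesis by (simp add: sawtooth_def divide_simps mult.commute)
qed

lemma sawtooth_lipschitz: "\<bar>sawtooth r x - sawtooth r y\<bar> \<le> \<bar>x - y\<bar>"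
  using sawtooth_le_add[of r x y] sawtooth_le_add[of r y x] by linarith

lemma sawtooth_dyadic:
  assumes "q \<le> r"
  shows "sawtooth r (of_int N / 2 ^ q) = 0"
proof -
  have "2 ^ r * (of_int N / 2 ^ q :: real) = of_int (N * 2 ^ (r - q))"
  proof -
    have "(2::real) ^ r = 2 ^ (r - q) * 2 ^ q" using assms by (simp flip: power_add)
    then show ?thesis by simp
  qed
  then show ?thesis by (simp add: sawtooth_def del: of_int_mult of_int_power)
qed

lemma sawtooth_mid: "sawtooth r ((of_int N + 1 / 2) / 2 ^ r) = 1 / 2 / 2 ^ r"
  by (simp add: sawtooth_def round_def)

text \<open>Dyadic intervals are nested; the index of the coarser one is the quotient of
  \<open>N\<close> by \<open>2 ^ (q - p)\<close>. One \<open>M\<close> serves the whole interval, so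
  that one affine formula can hold on it.\<close>

lemma dyadic_interval_refine:
  assumes "p \<le> q"
  shows "\<exists>M. \<forall>y::real. of_int N \<le> 2 ^ q * y \<and> 2 ^ q * y \<le> of_int N + 1 \<longrightarrow>
    of_int M \<le> 2 ^ p * y \<and> 2 ^ p * y \<le> of_int M + 1"
proof (intro exI allI impI)
  let ?K = "2 ^ (q - p) :: int"
  fix y :: real assume y: "of_int N \<le> 2 ^ q * y \<and> 2 ^ q * y \<le> of_int N + 1"
  have "(2::real) ^ q = 2 ^ (q - p) * 2 ^ p" using assms by (simp flip: power_add)
  then have K: "2 ^ q * y = of_int ?K * (2 ^ p * y)" by simp
  have "0 \<le> N mod ?K" "N mod ?K < ?K" by simp_all
  then have "N div ?K * ?K \<le> N" "N + 1 \<le> (N div ?K + 1) * ?K"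
    using div_mult_mod_eq[of N ?K] unfolding distrib_right by linarith+
  then have "real_of_int (N div ?K * ?K) \<le> of_int N" "real_of_int (N + 1) \<le> of_int ((N div ?K + 1) * ?K)"
    by (simp_all only: of_int_le_iff)
  then have "of_int ?K * of_int (N div ?K) \<le> of_int ?K * (2 ^ p * y)"
    "of_int ?K * (2 ^ p * y) \<le> of_int ?K * (of_int (N div ?K) + 1)"
    using y unfolding K by (simp_all only: of_int_mult of_int_add of_int_1 mult.commute) linarith+
  then show "of_int (N div ?K) \<le> 2 ^ p * y \<and> 2 ^ p * y \<le> of_int (N div ?K) + 1"
    by (auto simp: mult_le_cancel_left)
qed

lemma sawtooth_affine:
  assumes "r < q"
  shows "\<exists>s c. \<forall>y. of_int N \<le> 2 ^ q * y \<and> 2 ^ q * y \<le> of_int N + 1 \<longrightarrow> sawtooth r y = s * y + c"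
proof -
  obtain M where M: "\<And>y::real. of_int N \<le> 2 ^ q * y \<and> 2 ^ q * y \<le> of_int N + 1 \<Longrightarrow>
    of_int M \<le> 2 ^ Suc r * y \<and> 2 ^ Suc r * y \<le> of_int M + 1"
    using dyadic_interval_refine[of "Suc r" q N] assms by auto
  \<comment> \<open>At distance exactly 1/2 rounding may pick the other neighbour, but the distance
    is the same. Hence closed intervals can be treated.\<close>
  have near: "\<bar>x - of_int (round x)\<bar> = \<bar>x - of_int k\<bar>" if "\<bar>x - of_int k\<bar> \<le> 1 / 2" for x :: real and k
  proof (cases "round x = k")
    case False
    then have "1 \<le> \<bar>round x - k\<bar>" by linarith
    then have "1 \<le> real_of_int \<bar>round x - k\<bar>" by linarith
    then have "1 \<le> \<bar>real_of_int (round x) - of_int k\<bar>" by simp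
    then show ?thesis using round_diff_minimal[of x k] that by linarith
  qed simp
  \<comment> \<open>The parity of \<open>M\<close> tells whether the half period is a rising or a
    falling one.\<close>
  show ?thesis
  proof (cases "even M")
    case True
    then obtain k where k: "M = 2 * k" by blast
    have "sawtooth r y = 1 * y + - of_int k / 2 ^ r"
      if "of_int N \<le> 2 ^ q * y \<and> 2 ^ q * y \<le> of_int N + 1" for y
    proof -
      have "of_int k \<le> 2 ^ r * y" "2 ^ r * y \<le> of_int k + 1 / 2"
        using M[OF that] k by auto
      then show ?thesis using near[of "2 ^ r * y" k] by (simp add: sawtooth_def diff_divide_distrib)
    qed
    then show ?thesis by blast
  next
    case False
    then obtain k where k: "M = 2 * k + 1" by (rule oddE)
    have "sawtooth r y = -1 * y + (of_int k + 1) / 2 ^ r"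
      if "of_int N \<le> 2 ^ q * y \<and> 2 ^ q * y \<le> of_int N + 1" for y
    proof -
      have "of_int k + 1 / 2 \<le> 2 ^ r * y" "2 ^ r * y \<le> of_int k + 1"
        using M[OF that] k by auto
      then show ?thesis using near[of "2 ^ r * y" "k + 1"] by (simp add: sawtooth_def diff_divide_distrib)
    qed
    then show ?thesis by blast
  qed
qed

text \<open>The sawtooth cut off outside \<open>[(b - 1) / 2 ^ n, (b + 2) / 2 ^ n]\<close>. Since it vanishes at the
  endpoints when \<open>n \<le> r\<close>, the minimum realises the cut-off without destroying the Lipschitz
  constant.\<close>

definition cut_sawtooth :: "nat \<Rightarrow> nat \<Rightarrow> nat \<Rightarrow> real \<Rightarrow> real" where
  "cut_sawtooth r n b y =
     min (sawtooth r y) (max 0 (min (y - (real b - 1) / 2 ^ n) ((real b + 2) / 2 ^ n - y)))"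

lemma cut_sawtooth_nonneg: "0 \<le> cut_sawtooth r n b y"
  by (simp add: cut_sawtooth_def sawtooth_nonneg)

lemma cut_sawtooth_le: "cut_sawtooth r n b y \<le> 1 / 2 ^ r"
  using sawtooth_le[of r y] by (simp add: cut_sawtooth_def min_le_iff_disj)

lemma cut_sawtooth_lipschitz: "\<bar>cut_sawtooth r n b x - cut_sawtooth r n b y\<bar> \<le> \<bar>x - y\<bar>"
proof -
  have min: "\<bar>min a b - min c d\<bar> \<le> e" if "\<bar>a - c\<bar> \<le> e" "\<bar>b - d\<bar> \<le> e" for a b c d e :: real
    using that by linarith
  have max: "\<bar>max 0 a - max 0 b\<bar> \<le> e" if "\<bar>a - b\<bar> \<le> e" for a b e :: real
    using that by linarith
  show ?thesis unfolding cut_sawtooth_def by (intro min max sawtooth_lipschitz) linarith+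
qed

lemma cut_sawtooth_zero: "sawtooth r y = 0 \<Longrightarrow> cut_sawtooth r n b y = 0"
  by (simp add: cut_sawtooth_def)

lemma cut_sawtooth_support:
  assumes "cut_sawtooth r n b y \<noteq> 0"
  shows "\<bar>2 ^ n * y - real b\<bar> \<le> 2"
proof -
  have "(real b - 1) / 2 ^ n < y" "y < (real b + 2) / 2 ^ n"
    using assms sawtooth_nonneg[of r y] by (auto simp: cut_sawtooth_def min_def max_def split: if_splits)
  then have "real b - 1 < 2 ^ n * y" "2 ^ n * y < real b + 2"
    by (simp_all add: divide_simps mult.commute)
  then show ?thesis by linarith
qed

lemma cut_sawtooth_inside:
  assumes "n \<le> r" "real b - 1 \<le> 2 ^ n * y" "2 ^ n * y \<le> real b + 2"
  shows "cut_sawtooth r n b y = sawtooth r y"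
proof -
  have "sawtooth r ((real b - 1) / 2 ^ n) = 0" "sawtooth r ((real b + 2) / 2 ^ n) = 0"
    using sawtooth_dyadic[OF assms(1), of "int b - 1"] sawtooth_dyadic[OF assms(1), of "int b + 2"] by simp_all
  moreover have "(real b - 1) / 2 ^ n \<le> y" "y \<le> (real b + 2) / 2 ^ n"
    using assms(2,3) by (simp_all add: divide_simps mult.commute)
  ultimately have "sawtooth r y \<le> y - (real b - 1) / 2 ^ n" "sawtooth r y \<le> (real b + 2) / 2 ^ n - y"
    using sawtooth_le_add[of r y "(real b - 1) / 2 ^ n"] sawtooth_le_add[of r y "(real b + 2) / 2 ^ n"]
    by linarith+
  then show ?thesis by (simp add: cut_sawtooth_def)
qed

lemma cut_sawtooth_affine:
  assumes "n \<le> r" "r < q"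
  shows "\<exists>s c. \<forall>y. of_int N \<le> 2 ^ q * y \<and> 2 ^ q * y \<le> of_int N + 1 \<longrightarrow> cut_sawtooth r n b y = s * y + c"
proof -
  obtain M where M: "\<And>y::real. of_int N \<le> 2 ^ q * y \<and> 2 ^ q * y \<le> of_int N + 1 \<Longrightarrow>
    of_int M \<le> 2 ^ n * y \<and> 2 ^ n * y \<le> of_int M + 1"
    using dyadic_interval_refine[of n q N] assms by auto
  obtain s c where sc: "\<And>y. of_int N \<le> 2 ^ q * y \<and> 2 ^ q * y \<le> of_int N + 1 \<Longrightarrow> sawtooth r y = s * y + c"
    using sawtooth_affine[OF assms(2), of N] by blast
  \<comment> \<open>The ends of the window are grid points of level \<open>n\<close>, so an interval
    of that level lies inside the window or to one side of it, and the cut-off adds no kink in its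
    interior.\<close>
  consider "int b - 1 \<le> M" "M + 1 \<le> int b + 2" | "M + 1 \<le> int b - 1" | "int b + 2 \<le> M" by linarith
  then show ?thesis
  proof cases
    case 1
    then have "real b - 1 \<le> of_int M" "of_int M + 1 \<le> real b + 2" by linarith+
    then have "cut_sawtooth r n b y = s * y + c"
      if "of_int N \<le> 2 ^ q * y \<and> 2 ^ q * y \<le> of_int N + 1" for y
      using M[OF that] sc[OF that] cut_sawtooth_inside[OF assms(1), of b y] by linarith
    then show ?thesis by blast
  next
    case 2
    then have *: "of_int M + 1 \<le> real b - 1" by linarith
    have "cut_sawtooth r n b y = 0 * y + 0"
      if "of_int N \<le> 2 ^ q * y \<and> 2 ^ q * y \<le> of_int N + 1" for y
    proof -
      have "y \<le> (real b - 1) / 2 ^ n" using M[OF that] * by (simp add: divide_simps mult.commute)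
      then have "max 0 (min (y - (real b - 1) / 2 ^ n) ((real b + 2) / 2 ^ n - y)) = 0" by linarith
      then show ?thesis using sawtooth_nonneg[of r y] by (simp add: cut_sawtooth_def)
    qed
    then show ?thesis by blast
  next
    case 3
    then have *: "real b + 2 \<le> of_int M" by linarith
    have "cut_sawtooth r n b y = 0 * y + 0"
      if "of_int N \<le> 2 ^ q * y \<and> 2 ^ q * y \<le> of_int N + 1" for y
    proof -
      have "(real b + 2) / 2 ^ n \<le> y" using M[OF that] * by (simp add: divide_simps mult.commute)
      then have "max 0 (min (y - (real b - 1) / 2 ^ n) ((real b + 2) / 2 ^ n - y)) = 0" by linarith
      then show ?thesis using sawtooth_nonneg[of r y] by (simp add: cut_sawtooth_def)
    qed
    then show ?thesis by blast
  qed
qed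

lemma cut_sawtooth_differentiable:
  assumes "n \<le> r" and y: "\<And>N::int. y \<noteq> of_int N / 2 ^ Suc r"
  shows "cut_sawtooth r n b differentiable (at y)"
proof -
  define N where "N = \<lfloor>2 ^ Suc r * y\<rfloor>"
  have ne: "2 ^ Suc r * y \<noteq> of_int N" using y[of N] by (auto simp: field_simps)
  obtain s c where sc: "\<And>y. of_int N \<le> 2 ^ Suc r * y \<and> 2 ^ Suc r * y \<le> of_int N + 1 \<Longrightarrow>
      cut_sawtooth r n b y = s * y + c"
    using cut_sawtooth_affine[OF assms(1) lessI, of N b] by blast
  have "open {y. of_int N < 2 ^ Suc r * y \<and> 2 ^ Suc r * y < of_int N + (1::real)}"
    by (intro open_Collect_conj open_Collect_less continuous_intros)
  moreover have "of_int N < 2 ^ Suc r * y \<and> 2 ^ Suc r * y < of_int N + 1"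
    using ne unfolding N_def by linarith
  moreover have "((\<lambda>y. s * y + c) has_derivative (\<lambda>h. s * h)) (at y)"
    by (auto intro!: derivative_eq_intros)
  ultimately have "(cut_sawtooth r n b has_derivative (\<lambda>h. s * h)) (at y)"
    by (elim has_derivative_transform_within_open) (auto simp: sc)
  then show ?thesis unfolding differentiable_def by blast
qed

text \<open>The tail from \<open>K\<close> on is at most a multiple of the squared distance to
  \<open>x\<close>. It therefore vanishes at \<open>x\<close> with derivative 0, without any control
  of the derivatives of its terms.\<close>

lemma suminf_differentiable:
  fixes t :: "nat \<Rightarrow> 'a::euclidean_space \<Rightarrow> real"
  assumes diff: "\<And>k. t k differentiable (at x)"
    and sm: "\<And>y. summable (\<lambda>k. t k y)"
    and bnd: "\<And>k y. K \<le> k \<Longrightarrow> \<bar>t k y\<bar> \<le> c k * (norm (y - x))\<^sup>2"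
    and c: "summable c"
  shows "(\<lambda>y. \<Sum>k. t k y) differentiable (at x)"
proof -
  define tail where "tail y = (\<Sum>k. t (k + K) y)" for y
  have c': "summable (\<lambda>k. c (k + K))" using c by (simp add: summable_iff_shift)
  have tail: "\<bar>tail y\<bar> \<le> (\<Sum>k. c (k + K)) * (norm (y - x))\<^sup>2" for y
  proof -
    have *: "summable (\<lambda>k. c (k + K) * (norm (y - x))\<^sup>2)" using c' by (rule summable_mult2)
    have "norm (tail y) \<le> (\<Sum>k. c (k + K) * (norm (y - x))\<^sup>2)"
      unfolding tail_def by (rule norm_suminf_le[OF _ *]) (use bnd in auto)
    then show ?thesis using suminf_mult2[OF c', of "(norm (y - x))\<^sup>2"] by simp
  qed
  have tx: "tail x = 0" using tail[of x] by simp
  have "(tail has_derivative (\<lambda>_. 0)) (at x)"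
  proof (rule has_derivativeI_sandwich[of 1])
    show "((\<lambda>y. (\<Sum>k. c (k + K)) * norm (y - x)) \<longlongrightarrow> 0) (at x)"
      by (auto intro!: tendsto_eq_intros)
    fix y assume "y \<noteq> x"
    then show "norm (tail y - tail x - 0) / norm (y - x) \<le> (\<Sum>k. c (k + K)) * norm (y - x)"
      using tail[of y] tx by (simp add: divide_simps power2_eq_square)
  qed auto
  then have "tail differentiable (at x)" unfolding differentiable_def by blast
  moreover have "(\<Sum>k. t k y) = tail y + (\<Sum>k<K. t k y)" for y
    unfolding tail_def by (rule suminf_split_initial_segment[OF sm])
  moreover have "(\<lambda>y. \<Sum>k<K. t k y) differentiable (at x)" using diff by simp
  ultimately show ?thesis by simp
qed

section \<open>Auxiliary facts on tolerances, coordinates and substitution\<close>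

lemma eventually_div_power2:
  fixes C \<epsilon> :: real
  assumes "0 < \<epsilon>"
  shows "\<forall>\<^sub>F n in sequentially. C / 2 ^ n < \<epsilon>"
proof -
  have "(\<lambda>n. C * (1 / 2) ^ n) \<longlonglongrightarrow> C * 0"
    by (intro tendsto_mult tendsto_const LIMSEQ_power_zero) simp
  then have "\<forall>\<^sub>F n in sequentially. C * (1 / 2) ^ n < \<epsilon>"
    using assms by (intro order_tendstoD) auto
  then show ?thesis by (simp add: power_divide)
qed

lemma idx_less: "idx (j :: 'n::finite) < CARD('n)"
  using bij_betwE[OF to_nat_on_finite[of "UNIV :: 'n set"]] by simp

lemma idx_eq_iff: "idx (i :: 'n::finite) = idx j \<longleftrightarrow> i = j"
  using bij_betw_imp_inj_on[OF to_nat_on_finite[of "UNIV :: 'n set"]] by (simp add: inj_eq)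

lemma idx_surj:
  assumes "n < CARD('n::finite)"
  shows "\<exists>j::'n. idx j = n"
proof -
  have "n \<in> range (idx :: 'n \<Rightarrow> nat)"
    using to_nat_on_finite[of "UNIV :: 'n set"] assms by (simp add: bij_betw_def)
  then show ?thesis by blast
qed

lemma negligible_UN:
  assumes "countable I" "\<And>i. i \<in> I \<Longrightarrow> negligible (S i)"
  shows "negligible (\<Union>i\<in>I. S i)"
  by (rule negligible_countable_Union) (use assms in auto)

lemma decidable_comp1:
  assumes "decidable 1 (\<lambda>xs. P (xs ! 0))" "computable k F"
  shows "decidable k (\<lambda>xs. P (F xs))"
  using computable_comp[OF assms(1)[unfolded decidable_def], of "[F]" k] assms(2)
  by (simp add: decidable_def)

lemma computable_rat_comp3:
  assumes "computable_rat 3 F" "computable k A" "computable k B" "computable k C"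
  shows "computable_rat k (\<lambda>xs. F [A xs, B xs, C xs])"
  using computable_rat_comp[OF assms(1), of "[A, B, C]" k] assms(2-4) by auto

lemma real_card_le_power2: "real CARD('n::finite) \<le> 2 ^ CARD('n)"
  using of_nat_less_two_power[of "CARD('n)", where 'a = real] by simp

lemma abs_square_diff_le:
  fixes a b :: real
  assumes "0 \<le> a" "a \<le> c" "0 \<le> b" "b \<le> c"
  shows "\<bar>a\<^sup>2 - b\<^sup>2\<bar> \<le> 2 * c * \<bar>a - b\<bar>"
proof -
  have "a\<^sup>2 - b\<^sup>2 = (a + b) * (a - b)" by (simp add: power2_eq_square algebra_simps)
  moreover have "\<bar>a + b\<bar> * \<bar>a - b\<bar> \<le> (2 * c) * \<bar>a - b\<bar>"
    using assms by (intro mult_right_mono) auto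
  ultimately show ?thesis by (simp add: abs_mult)
qed

section \<open>A computable function that is not differentiable on a given null set\<close>

locale Pi02_code =
  fixes l u :: "nat list \<Rightarrow> real" and i0 :: "'n::finite"
  assumes l: "computable_rat 3 l" and u: "computable_rat 3 u"
begin

text \<open>The cell of level \<open>n\<close> with corner \<open>a\<close> is enlarged to
  \<open>R\<close> cell widths around the corner. In each of the first \<open>m + 1\<close> open
  sets it must fit strictly into one single box with index below the stage \<open>s\<close>; this is
  decidable, unlike being covered by the union.\<close>

definition inside :: "nat \<Rightarrow> nat \<Rightarrow> nat \<Rightarrow> nat \<Rightarrow> ('n \<Rightarrow> nat) \<Rightarrow> bool" where
  "inside m n R s a \<longleftrightarrow> (\<forall>i<Suc m. \<exists>k<s. \<forall>j\<in>UNIV.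
     l [i, k, idx j] < (real (a j) - real R) / 2 ^ n \<and> (real (a j) + real R) / 2 ^ n < u [i, k, idx j])"

definition layer :: "nat \<Rightarrow> nat" where "layer k = digit 0 k"
definition level :: "nat \<Rightarrow> nat" where "level k = digit 1 k"
definition corner :: "nat \<Rightarrow> 'n \<Rightarrow> nat" where "corner k j = digit (idx j + 2) k"
text \<open>In every coordinate a ripple lives within \<open>CARD('n) + 2\<close> cell widths of its
  corner, so a point beyond this radius has one cell width to spare.\<close>

definition radius :: nat where "radius = CARD('n) + 3"

text \<open>The factor 4 makes the larger cell contain the enlarged cells of the previous level around the
  same point.\<close>

definition active :: "nat \<Rightarrow> bool" where
  "active k \<longleftrightarrow> (unpair2 ^^ (CARD('n) + 2)) k \<le> 0 \<and>
     inside (layer k) (level k) radius (level k) (corner k) \<and>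
     \<not> inside (layer k) (level k) (4 * radius) (level k - 1) (corner k)"

definition near :: "nat \<Rightarrow> real ^ 'n \<Rightarrow> bool" where
  "near k x \<longleftrightarrow> (\<forall>j. \<bar>2 ^ level k * x $ j - real (corner k j)\<bar> \<le> real radius)"

definition boxes :: "nat \<Rightarrow> (real ^ 'n) set" where
  "boxes i = (\<Union>k. box (\<chi> j. l [i, k, idx j]) (\<chi> j. u [i, k, idx j]))"

lemma level_le: "level k \<le> k"
  unfolding level_def by (rule digit_le)

lemma corner_surj: "\<exists>k. layer k = m \<and> level k = n \<and> corner k = a \<and> (unpair2 ^^ (CARD('n) + 2)) k = 0"
proof -
  let ?inv = "inv_into UNIV (idx :: 'n \<Rightarrow> nat)"
  define b where "b i = (if i = 0 then m else if i = 1 then n else a (?inv (i - 2)))" for i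
  obtain k where k: "\<And>j. j < CARD('n) + 2 \<Longrightarrow> digit j k = b j" "(unpair2 ^^ (CARD('n) + 2)) k = 0"
    using digit_surj[of "CARD('n) + 2" b] by blast
  have "corner k j = a j" for j
  proof -
    have "?inv (idx j) = j" by (rule inv_into_f_f) (auto simp: inj_on_def idx_eq_iff)
    then show ?thesis using k(1)[of "idx j + 2"] idx_less[of j] by (simp add: corner_def b_def)
  qed
  then show ?thesis using k by (intro exI[of _ k]) (auto simp: layer_def level_def b_def)
qed

text \<open>The point has a positive distance to the faces of its open boxes, which eventually
  exceeds \<open>S + R\<close> cell widths, and the stage eventually passes the indices of these
  boxes. The stage \<open>n - 1\<close> is that of the negated clause of \<open>active\<close>: the
  lemma ends activity near \<open>x\<close>, and it also provides a covered cell in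
  \<open>ex_active\<close>.\<close>

lemma eventually_inside:
  assumes x: "\<And>i. i \<le> m \<Longrightarrow> x \<in> boxes i"
  shows "\<forall>\<^sub>F n in sequentially. \<forall>a. (\<forall>j. \<bar>2 ^ n * x $ j - real (a j)\<bar> \<le> real S) \<longrightarrow> inside m n R (n - 1) a"
proof -
  have "\<forall>\<^sub>F n in sequentially. \<forall>a. (\<forall>j. \<bar>2 ^ n * x $ j - real (a j)\<bar> \<le> real S) \<longrightarrow>
     (\<exists>k<n - 1. \<forall>j\<in>UNIV. l [i, k, idx j] < (real (a j) - real R) / 2 ^ n \<and>
        (real (a j) + real R) / 2 ^ n < u [i, k, idx j])" if i: "i \<le> m" for i
  proof -
    obtain k where k: "\<And>j. l [i, k, idx j] < x $ j \<and> x $ j < u [i, k, idx j]"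
      using x[OF i] unfolding boxes_def by (auto simp: mem_box_cart)
    have "\<forall>\<^sub>F n in sequentially. \<forall>j::'n. (real S + real R) / 2 ^ n < x $ j - l [i, k, idx j] \<and>
       (real S + real R) / 2 ^ n < u [i, k, idx j] - x $ j"
      using k by (intro eventually_all_finite eventually_conj eventually_div_power2) (auto simp: algebra_simps)
    moreover have "\<forall>\<^sub>F n in sequentially. k < n - 1"
      by (rule eventually_sequentiallyI[of "k + 2"]) simp
    ultimately show ?thesis
    proof eventually_elim
      case (elim n)
      show ?case
      proof (intro allI impI exI[of _ k] conjI ballI)
        fix a and j :: 'n assume "\<forall>j. \<bar>2 ^ n * x $ j - real (a j)\<bar> \<le> real S"
        then have *: "2 ^ n * x $ j - real S \<le> real (a j)" "real (a j) \<le> 2 ^ n * x $ j + real S"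
          by (auto simp: abs_le_iff algebra_simps dest!: spec[of _ j])
        have "(2 ^ n * x $ j - (real S + real R)) / 2 ^ n \<le> (real (a j) - real R) / 2 ^ n"
          using * by (intro divide_right_mono) auto
        then have "x $ j - (real S + real R) / 2 ^ n \<le> (real (a j) - real R) / 2 ^ n"
          by (simp add: diff_divide_distrib)
        then show "l [i, k, idx j] < (real (a j) - real R) / 2 ^ n" using elim(1) by (smt (verit))
        have "(real (a j) + real R) / 2 ^ n \<le> (2 ^ n * x $ j + (real S + real R)) / 2 ^ n"
          using * by (intro divide_right_mono) auto
        then have "(real (a j) + real R) / 2 ^ n \<le> x $ j + (real S + real R) / 2 ^ n"
          by (simp add: add_divide_distrib)
        then show "(real (a j) + real R) / 2 ^ n < u [i, k, idx j]" using elim(1) by (smt (verit))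
      qed (use elim in simp)
    qed
  qed
  then have "\<forall>\<^sub>F n in sequentially. \<forall>i\<in>{..m}. \<forall>a. (\<forall>j. \<bar>2 ^ n * x $ j - real (a j)\<bar> \<le> real S) \<longrightarrow>
     (\<exists>k<n - 1. \<forall>j\<in>UNIV. l [i, k, idx j] < (real (a j) - real R) / 2 ^ n \<and>
        (real (a j) + real R) / 2 ^ n < u [i, k, idx j])"
    by (intro eventually_ball_finite) auto
  then show ?thesis
    by eventually_elim (simp add: inside_def less_Suc_eq_le)
qed

lemma active_near_boxes:
  assumes "active k" "near k x" "i \<le> layer k"
  shows "x \<in> boxes i"
proof -
  obtain k' where k': "\<And>j. l [i, k', idx j] < (real (corner k j) - real radius) / 2 ^ level k \<and>
      (real (corner k j) + real radius) / 2 ^ level k < u [i, k', idx j]"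
  proof -
    have "inside (layer k) (level k) radius (level k) (corner k)" using assms(1) by (simp add: active_def)
    then show ?thesis using assms(3) that unfolding inside_def less_Suc_eq_le by blast
  qed
  have "l [i, k', idx j] < x $ j \<and> x $ j < u [i, k', idx j]" for j
  proof -
    have *: "\<bar>2 ^ level k * x $ j - real (corner k j)\<bar> \<le> real radius" using assms(2) by (simp add: near_def)
    have "(real (corner k j) - real radius) / 2 ^ level k \<le> x $ j"
      "x $ j \<le> (real (corner k j) + real radius) / 2 ^ level k"
      using * by (auto simp: divide_simps abs_le_iff algebra_simps)
    then show ?thesis using k'[of j] by linarith
  qed
  then show ?thesis unfolding boxes_def by (auto simp: mem_box_cart intro!: exI[of _ k'])
qed

text \<open>If \<open>x\<close> avoids the \<open>M\<close>-th set, no active cell near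
  \<open>x\<close> has a layer from \<open>M\<close> on. In a smaller layer, either \<open>x\<close>
  avoids one of the sets concerned, or fine cells near \<open>x\<close> were covered one stage
  earlier and are not active. So layers and levels are bounded, hence corners too, and only finitely
  many codes remain.\<close>

lemma finite_active_near:
  assumes "x \<notin> (\<Inter>i. boxes i)"
  shows "finite {k. active k \<and> near k x}"
proof -
  obtain M where M: "x \<notin> boxes M" using assms by auto
  have "\<exists>n0. \<forall>k. active k \<and> near k x \<and> layer k = m \<longrightarrow> level k < n0" for m
  proof (cases "\<forall>i\<le>m. x \<in> boxes i")
    case True
    then obtain n0 where n0: "\<And>n a. n0 \<le> n \<Longrightarrow> \<forall>j. \<bar>2 ^ n * x $ j - real (a j)\<bar> \<le> real radius \<Longrightarrow>
        inside m n (4 * radius) (n - 1) a"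
      using eventually_inside[of m x radius "4 * radius"] unfolding eventually_sequentially by blast
    have "level k < n0" if "active k \<and> near k x \<and> layer k = m" for k
      using that n0[of "level k" "corner k"] by (auto simp: active_def near_def not_le[symmetric])
    then show ?thesis by blast
  next
    case False
    then show ?thesis using active_near_boxes by blast
  qed
  then obtain n0 where n0: "\<And>m k. active k \<Longrightarrow> near k x \<Longrightarrow> layer k = m \<Longrightarrow> level k < n0 m" by metis
  define L where "L = (\<Sum>m<M. n0 m)"
  define B where "B = M + L + (\<Sum>j\<in>UNIV. nat \<lceil>2 ^ L * \<bar>x $ j\<bar> + real radius\<rceil>)"
  have "digit j k \<le> B" if k: "active k" "near k x" and j: "j < CARD('n) + 2" for k j
  proof -
    have lay: "layer k < M" using active_near_boxes[OF k, of M] M by (auto simp: not_le[symmetric])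
    have "level k < n0 (layer k)" using n0 k by blast
    also have "\<dots> \<le> L" unfolding L_def using lay by (intro member_le_sum) auto
    finally have lev: "level k < L" .
    consider "j = 0" | "j = 1" | i where "i < CARD('n)" "j = i + 2"
    proof (cases "j < 2")
      case True
      then have "j = 0 \<or> j = 1" by linarith
      then show ?thesis using that(1,2) by blast
    next
      case False
      then show ?thesis using that(3)[of "j - 2"] j by simp
    qed
    then show ?thesis
    proof cases
      case 3
      obtain i' :: 'n where i': "idx i' = i" using idx_surj[OF 3(1)] by blast
      have "real (corner k i') \<le> 2 ^ level k * x $ i' + real radius"
        using k(2) by (auto simp: near_def abs_le_iff dest!: spec[of _ i'])
      also have "2 ^ level k * x $ i' \<le> 2 ^ level k * \<bar>x $ i'\<bar>" by (intro mult_left_mono) auto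
      also have "\<dots> \<le> 2 ^ L * \<bar>x $ i'\<bar>" using lev by (intro mult_right_mono power_increasing) auto
      finally have "corner k i' \<le> nat \<lceil>2 ^ L * \<bar>x $ i'\<bar> + real radius\<rceil>" by linarith
      also have "\<dots> \<le> (\<Sum>j\<in>UNIV. nat \<lceil>2 ^ L * \<bar>x $ j\<bar> + real radius\<rceil>)"
        by (intro member_le_sum) auto
      finally show ?thesis using 3 i' by (simp add: corner_def B_def)
    qed (use lay lev in \<open>auto simp: layer_def level_def B_def\<close>)
  qed
  then have "{k. active k \<and> near k x} \<subseteq> {k. (\<forall>j<CARD('n) + 2. digit j k \<le> B) \<and> (unpair2 ^^ (CARD('n) + 2)) k = 0}"
    by (auto simp: active_def)
  then show ?thesis using finite_bounded_digits finite_subset by blast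
qed

text \<open>The cell containing \<open>z\<close> at the least level where it is
  \<open>inside\<close> is active. If its larger version were covered one stage earlier, so would be
  the cell of \<open>z\<close> at the previous level, against minimality.\<close>

lemma ex_active:
  assumes z: "z \<in> (\<Inter>i. boxes i)" "\<And>j. 0 \<le> z $ j"
  shows "\<exists>k. layer k = m \<and> active k \<and>
    (\<forall>j. real (corner k j) \<le> 2 ^ level k * z $ j \<and> 2 ^ level k * z $ j \<le> real (corner k j) + 1)"
proof -
  define a where "a n j = nat \<lfloor>2 ^ n * z $ j\<rfloor>" for n and j :: 'n
  have a: "real (a n j) \<le> 2 ^ n * z $ j" "2 ^ n * z $ j < real (a n j) + 1" for n j
    using z(2)[of j] by (simp_all add: a_def)
  have "\<forall>\<^sub>F n in sequentially. \<forall>b. (\<forall>j. \<bar>2 ^ n * z $ j - real (b j)\<bar> \<le> real 1) \<longrightarrow> inside m n radius (n - 1) b"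
    using z(1) by (intro eventually_inside) auto
  then obtain n1 where "\<forall>b. (\<forall>j. \<bar>2 ^ n1 * z $ j - real (b j)\<bar> \<le> real 1) \<longrightarrow> inside m n1 radius (n1 - 1) b"
    unfolding eventually_sequentially by blast
  moreover have "\<bar>2 ^ n1 * z $ j - real (a n1 j)\<bar> \<le> real 1" for j using a[where n=n1 and j=j] by auto
  ultimately have "inside m n1 radius (n1 - 1) (a n1)" by blast
  then have n1: "inside m n1 radius n1 (a n1)"
    unfolding inside_def by (meson diff_le_self order_less_le_trans)
  define n where "n = (LEAST n. inside m n radius n (a n))"
  have n: "inside m n radius n (a n)" unfolding n_def using n1 by (rule LeastI)
  \<comment> \<open>At stage 0 no box is available, so there is a previous level.\<close>
  then have "n \<noteq> 0" by (auto simp: inside_def)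
  then obtain n' where n': "n = Suc n'" by (cases n) auto
  have not: "\<not> inside m n' radius n' (a n')"
    using not_less_Least[of n' "\<lambda>n. inside m n radius n (a n)"] n' by (simp add: n_def)
  have "\<not> inside m n (4 * radius) (n - 1) (a n)"
  proof
    assume *: "inside m n (4 * radius) (n - 1) (a n)"
    have le: "(real (a n j) - real (4 * radius)) / 2 ^ n \<le> (real (a n' j) - real radius) / 2 ^ n'"
      "(real (a n' j) + real radius) / 2 ^ n' \<le> (real (a n j) + real (4 * radius)) / 2 ^ n" for j
    proof -
      have "real (a n j) < 2 * real (a n' j) + 2" "2 * real (a n' j) < real (a n j) + 1"
        using a[of n j] a[of n' j] unfolding n' by auto
      moreover have "3 \<le> real radius" by (simp add: radius_def)
      ultimately show "(real (a n j) - real (4 * radius)) / 2 ^ n \<le> (real (a n' j) - real radius) / 2 ^ n'"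
        "(real (a n' j) + real radius) / 2 ^ n' \<le> (real (a n j) + real (4 * radius)) / 2 ^ n"
        unfolding n' by (auto simp: divide_simps)
    qed
    have "inside m n' radius n' (a n')"
      unfolding inside_def
    proof (intro allI impI)
      fix i assume "i < Suc m"
      then obtain k where k: "k < n'" "\<And>j. l [i, k, idx j] < (real (a n j) - real (4 * radius)) / 2 ^ n \<and>
          (real (a n j) + real (4 * radius)) / 2 ^ n < u [i, k, idx j]"
        using * unfolding inside_def n' diff_Suc_1 by blast
      show "\<exists>k<n'. \<forall>j\<in>UNIV. l [i, k, idx j] < (real (a n' j) - real radius) / 2 ^ n' \<and>
          (real (a n' j) + real radius) / 2 ^ n' < u [i, k, idx j]"
      proof (intro exI[of _ k] conjI ballI)
        show "l [i, k, idx j] < (real (a n' j) - real radius) / 2 ^ n'"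
          "(real (a n' j) + real radius) / 2 ^ n' < u [i, k, idx j]" for j
          using k(2)[of j] le[of j] by linarith+
      qed (rule k(1))
    qed
    with not show False by blast
  qed
  moreover obtain k where k: "layer k = m" "level k = n" "corner k = a n" "(unpair2 ^^ (CARD('n) + 2)) k = 0"
    using corner_surj by blast
  ultimately have "active k" using n by (simp add: active_def)
  then show ?thesis using k a[of n] by (intro exI[of _ k]) (auto intro: less_imp_le)
qed

lemma decidable_inside:
  assumes M: "computable k M" and N: "computable k N" and S: "computable k S"
    and A: "\<And>j. computable k (A j)"
  shows "decidable k (\<lambda>xs. inside (M xs) (N xs) R (S xs) (\<lambda>j. A j xs))"
  unfolding inside_def
  by (intro decidable_Ball_less decidable_Bex_less decidable_Ball_finite decidable_conj
      computable_rat_intros computable_rat_comp3 l u computable_Suc computable_const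
      computable_hd computable_hd_tl computable_tl_tl[OF A] computable_tl_tl[OF N] computable_tl[OF S] M finite) simp_all

lemma decidable_active:
  assumes "computable k F"
  shows "decidable k (\<lambda>xs. active (F xs))"
proof -
  have un: "computable 1 (\<lambda>xs. (unpair2 ^^ j) (xs ! 0))" for j
    by (induction j) (auto intro!: computable_nth computable_unpair)
  have "decidable 1 (\<lambda>xs. active (xs ! 0))"
    unfolding active_def layer_def level_def corner_def
    by (intro decidable_conj decidable_not decidable_inside decidable_le un computable_digit computable_diff
        computable_nth computable_const) simp_all
  then show ?thesis using assms by (rule decidable_comp1)
qed

section \<open>The ripples and the computability of their sum\<close>

text \<open>The square makes the weight differentiable where the maximum switches.\<close>

definition weight :: "nat \<Rightarrow> real ^ 'n \<Rightarrow> real" where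
  "weight k x = (max 0 (real CARD('n) - (\<Sum>j\<in>UNIV - {i0}. \<bar>2 ^ level k * x $ j - real (corner k j)\<bar>)))\<^sup>2"

text \<open>The code \<open>k\<close> rather than the level sets the frequency, so that no two cells
  share one. The weight omits the coordinate \<open>i0\<close> and is constant in the direction of
  oscillation.\<close>

definition ripple :: "nat \<Rightarrow> real ^ 'n \<Rightarrow> real" where
  "ripple k x = (if active k
     then cut_sawtooth (3 * k) (level k) (corner k i0) (x $ i0) * weight k x else 0)"

definition wave :: "real ^ 'n \<Rightarrow> real" where
  "wave x = (\<Sum>k. ripple k x)"

lemma weight_nonneg: "0 \<le> weight k x"
  by (simp add: weight_def)

lemma weight_le: "weight k x \<le> (real CARD('n))\<^sup>2"
  unfolding weight_def by (intro power_mono) (auto simp: sum_nonneg)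

lemma weight_lipschitz: "\<bar>weight k x - weight k y\<bar> \<le> 2 * (real CARD('n))\<^sup>2 * 2 ^ level k * norm (x - y)"
proof -
  define s where "s x = (\<Sum>j\<in>UNIV - {i0}. \<bar>2 ^ level k * x $ j - real (corner k j)\<bar>)" for x :: "real ^ 'n"
  have "\<bar>s x - s y\<bar> \<le> (\<Sum>j\<in>UNIV - {i0}. 2 ^ level k * norm (x - y))"
  proof -
    have "\<bar>s x - s y\<bar> \<le> (\<Sum>j\<in>UNIV - {i0}. \<bar>\<bar>2 ^ level k * x $ j - real (corner k j)\<bar> - \<bar>2 ^ level k * y $ j - real (corner k j)\<bar>\<bar>)"
      unfolding s_def by (simp flip: sum_subtractf)
    also have "\<dots> \<le> (\<Sum>j\<in>UNIV - {i0}. 2 ^ level k * norm (x - y))"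
    proof (intro sum_mono)
      fix j
      have "\<bar>\<bar>2 ^ level k * x $ j - real (corner k j)\<bar> - \<bar>2 ^ level k * y $ j - real (corner k j)\<bar>\<bar>
          \<le> \<bar>2 ^ level k * x $ j - 2 ^ level k * y $ j\<bar>" by linarith
      also have "\<dots> = 2 ^ level k * \<bar>(x - y) $ j\<bar>" by (simp add: abs_mult flip: right_diff_distrib)
      also have "\<dots> \<le> 2 ^ level k * norm (x - y)" by (intro mult_left_mono component_le_norm_cart) simp
      finally show "\<bar>\<bar>2 ^ level k * x $ j - real (corner k j)\<bar> - \<bar>2 ^ level k * y $ j - real (corner k j)\<bar>\<bar>
          \<le> 2 ^ level k * norm (x - y)" .
    qed
    finally show ?thesis .
  qed
  also have "\<dots> \<le> real CARD('n) * (2 ^ level k * norm (x - y))"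
    by (simp add: card_Diff_singleton mult_right_mono)
  finally have s: "\<bar>s x - s y\<bar> \<le> real CARD('n) * (2 ^ level k * norm (x - y))" .
  have s0: "0 \<le> s x" for x unfolding s_def by (simp add: sum_nonneg)
  have "\<bar>weight k x - weight k y\<bar> \<le> 2 * real CARD('n) * \<bar>max 0 (real CARD('n) - s x) - max 0 (real CARD('n) - s y)\<bar>"
    unfolding weight_def s_def[symmetric] by (intro abs_square_diff_le) (auto simp: s0)
  also have "\<dots> \<le> 2 * real CARD('n) * (real CARD('n) * (2 ^ level k * norm (x - y)))"
  proof (rule mult_left_mono)
    have "\<bar>max 0 (real CARD('n) - s x) - max 0 (real CARD('n) - s y)\<bar> \<le> \<bar>s x - s y\<bar>" by linarith
    with s show "\<bar>max 0 (real CARD('n) - s x) - max 0 (real CARD('n) - s y)\<bar> \<le> real CARD('n) * (2 ^ level k * norm (x - y))" by linarith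
  qed simp
  finally show ?thesis by (simp add: power2_eq_square mult_ac)
qed

lemma ripple_nonneg: "0 \<le> ripple k x"
  by (simp add: ripple_def weight_nonneg cut_sawtooth_nonneg)

lemma ripple_le: "ripple k x \<le> (real CARD('n))\<^sup>2 / 8 ^ k"
proof -
  have "cut_sawtooth (3 * k) (level k) (corner k i0) (x $ i0) * weight k x \<le> 1 / 2 ^ (3 * k) * (real CARD('n))\<^sup>2"
    by (intro mult_mono cut_sawtooth_le weight_le weight_nonneg) simp
  then show ?thesis by (simp add: ripple_def power_mult)
qed

text \<open>The weight varies at a rate of order \<open>2 ^ level k\<close>, but it is multiplied by
  a height of at most \<open>1 / 2 ^ k\<close>. Since \<open>level k \<le> k\<close>, the constant
  does not depend on \<open>k\<close>.\<close>

lemma ripple_lipschitz: "\<bar>ripple k x - ripple k y\<bar> \<le> 3 * (real CARD('n))\<^sup>2 * norm (x - y)"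
proof (cases "active k")
  case True
  define g where "g x = cut_sawtooth (3 * k) (level k) (corner k i0) (x $ i0)" for x :: "real ^ 'n"
  have "ripple k x - ripple k y = (g x - g y) * weight k x + g y * (weight k x - weight k y)"
    using True by (simp add: ripple_def g_def algebra_simps)
  then have "\<bar>ripple k x - ripple k y\<bar> \<le> \<bar>g x - g y\<bar> * weight k x + g y * \<bar>weight k x - weight k y\<bar>"
    using weight_nonneg[of k x] cut_sawtooth_nonneg[of "3 * k" "level k" "corner k i0" "y $ i0"]
    by (simp add: g_def abs_mult order.trans[OF abs_triangle_ineq])
  also have "\<bar>g x - g y\<bar> * weight k x \<le> norm (x - y) * (real CARD('n))\<^sup>2"
  proof (intro mult_mono weight_le weight_nonneg)
    have "\<bar>g x - g y\<bar> \<le> \<bar>(x - y) $ i0\<bar>" unfolding g_def using cut_sawtooth_lipschitz by simp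
    also have "\<dots> \<le> norm (x - y)" by (rule component_le_norm_cart)
    finally show "\<bar>g x - g y\<bar> \<le> norm (x - y)" .
  qed simp
  also have "g y * \<bar>weight k x - weight k y\<bar> \<le> 1 / 2 ^ k * (2 * (real CARD('n))\<^sup>2 * 2 ^ k * norm (x - y))"
  proof (intro mult_mono)
    have "(2::real) ^ k \<le> 2 ^ (3 * k)" by (intro power_increasing) auto
    then have "1 / 2 ^ (3 * k) \<le> 1 / (2::real) ^ k" by (simp add: divide_simps)
    then show "g y \<le> 1 / 2 ^ k" unfolding g_def using cut_sawtooth_le order.trans by blast
    have "(2::real) ^ level k \<le> 2 ^ k" by (intro power_increasing level_le) auto
    then have "2 * (real CARD('n))\<^sup>2 * 2 ^ level k * norm (x - y) \<le> 2 * (real CARD('n))\<^sup>2 * 2 ^ k * norm (x - y)"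
      by (intro mult_mono) auto
    then show "\<bar>weight k x - weight k y\<bar> \<le> 2 * (real CARD('n))\<^sup>2 * 2 ^ k * norm (x - y)"
      using weight_lipschitz[of k x y] by linarith
  qed auto
  finally show ?thesis by (simp add: algebra_simps)
qed (simp add: ripple_def)

lemma ripple_le_half: "ripple k x \<le> (real CARD('n))\<^sup>2 * (1 / 2) ^ k"
proof -
  have "(2::real) ^ k \<le> 8 ^ k" by (intro power_mono) auto
  then have "(real CARD('n))\<^sup>2 / 8 ^ k \<le> (real CARD('n))\<^sup>2 / 2 ^ k" by (intro divide_left_mono) auto
  then show ?thesis using ripple_le[of k x] by (simp add: power_divide)
qed

lemma summable_half: "summable (\<lambda>k. (real CARD('n))\<^sup>2 * (1 / 2) ^ k :: real)"
  by (intro summable_mult summable_geometric) simp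

lemma summable_ripple: "summable (\<lambda>k. ripple k x)"
  by (rule summable_comparison_test'[OF summable_half, of 0]) (use ripple_nonneg ripple_le_half in auto)

lemma wave_tail:
  "0 \<le> wave x - (\<Sum>k<K. ripple k x)" "wave x - (\<Sum>k<K. ripple k x) \<le> 2 * (real CARD('n))\<^sup>2 / 2 ^ K"
proof -
  have eq: "wave x - (\<Sum>k<K. ripple k x) = (\<Sum>k. ripple (k + K) x)"
    unfolding wave_def using suminf_split_initial_segment[OF summable_ripple, of x K] by simp
  have sm: "summable (\<lambda>k. ripple (k + K) x)"
    by (rule summable_ignore_initial_segment[OF summable_ripple])
  show "0 \<le> wave x - (\<Sum>k<K. ripple k x)"
    unfolding eq by (intro suminf_nonneg sm ripple_nonneg)
  have "(\<Sum>k. ripple (k + K) x) \<le> (\<Sum>k. (real CARD('n))\<^sup>2 / 2 ^ K * (1 / 2) ^ k)"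
  proof (intro suminf_le sm summable_mult summable_geometric)
    fix k show "ripple (k + K) x \<le> (real CARD('n))\<^sup>2 / 2 ^ K * (1 / 2) ^ k"
      using ripple_le_half[of "k + K" x] by (simp add: power_add power_divide mult_ac)
  qed simp
  also have "\<dots> = (real CARD('n))\<^sup>2 / 2 ^ K * 2"
    by (subst suminf_mult) (simp_all add: suminf_geometric summable_geometric)
  finally show "wave x - (\<Sum>k<K. ripple k x) \<le> 2 * (real CARD('n))\<^sup>2 / 2 ^ K" unfolding eq by (simp add: mult.commute)
qed

lemma dim2_le: "(real CARD('n))\<^sup>2 \<le> 2 ^ (2 * CARD('n))"
  using power_mono[OF real_card_le_power2[where 'n = 'n], of 2] by (simp add: power_mult mult.commute flip: power_mult)

lemma computable_rat_ripple:
  assumes K: "computable k K" and M: "computable k M" and A: "\<And>j. computable k (A j)"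
  shows "computable_rat k (\<lambda>xs. ripple (K xs) (\<chi> j. real (A j xs) / 2 ^ M xs))"
proof -
  \<comment> \<open>Points of the cube have nonnegative coordinates, so rounding reduces to the
    floor in the natural numbers and a ripple has exact rational values at dyadic points.\<close>
  have saw: "sawtooth r y = \<bar>2 ^ r * y - real (nat \<lfloor>2 ^ r * y + 1 / 2\<rfloor>)\<bar> / 2 ^ r" if "0 \<le> y" for r y
    using that by (simp add: sawtooth_def round_def)
  have lev: "computable k (\<lambda>xs. level (K xs))" "computable k (\<lambda>xs. corner (K xs) j)" for j
    unfolding level_def corner_def by (intro computable_digit computable_const K)+
  have half: "computable_rat k (\<lambda>xs. 1 / 2)"
    using computable_rat_divide_Suc[OF computable_rat_1 computable_const[of k 1]] by simp
  have pt: "computable_rat k (\<lambda>xs. real (A j xs) / 2 ^ M xs)" for j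
    by (intro computable_rat_intros A M)
  have "computable_rat k (\<lambda>xs. sawtooth (3 * K xs) (real (A i0 xs) / 2 ^ M xs))"
    by (subst saw, simp) (intro computable_rat_intros computable_nat_floor half pt computable_mult computable_const K)
  then show ?thesis
    unfolding ripple_def weight_def cut_sawtooth_def power2_eq_square vec_lambda_beta
    by (intro computable_rat_intros computable_rat_sum_finite decidable_active pt lev K A M computable_const finite)
qed

lemma computable_on_cube_wave: "computable_on_cube wave"
  unfolding computable_on_cube_def
proof
  \<comment> \<open>These additional terms absorb the factor
    \<open>2 * (real CARD('n))\<^sup>2\<close> in the bound on the tail.\<close>
  define N where "N = 2 * CARD('n) + 1"
  define s where "s xs = (\<Sum>k<xs ! 0 + N. ripple k (\<chi> j. real (xs ! (idx j + 2)) / 2 ^ (xs ! 1)))" for xs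
  have "computable_rat (CARD('n) + 2) s"
    unfolding s_def
  proof (rule computable_rat_sum)
    show "computable (CARD('n) + 2) (\<lambda>xs. xs ! 0 + N)"
      by (intro computable_intros) simp
    show "computable_rat (Suc (CARD('n) + 2))
        (\<lambda>ys. ripple (hd ys) (\<chi> j. real (tl ys ! (idx j + 2)) / 2 ^ (tl ys ! 1)))"
      by (intro computable_rat_ripple computable_hd computable_nth_tl) (simp_all add: idx_less)
  qed
  moreover have "\<bar>s (p # m # as) - wave (dyadic_point m as)\<bar> \<le> 1 / 2 ^ p" for p m as
  proof -
    have "s (p # m # as) = (\<Sum>k<p + N. ripple k (dyadic_point m as))"
      by (simp add: s_def dyadic_point_def)
    then have "\<bar>s (p # m # as) - wave (dyadic_point m as)\<bar> \<le> 2 * (real CARD('n))\<^sup>2 / 2 ^ (p + N)"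
      using wave_tail[where x = "dyadic_point m as" and K = "p + N"] by linarith
    also have "\<dots> \<le> 2 * 2 ^ (2 * CARD('n)) / 2 ^ (p + N)"
      using dim2_le by (intro divide_right_mono) auto
    also have "\<dots> = 1 / 2 ^ p" by (simp add: N_def power_add)
    finally show ?thesis .
  qed
  ultimately show "\<exists>s. computable_rat (CARD('n) + 2) s \<and>
      (\<forall>p m as. length as = CARD('n) \<and> (\<forall>a\<in>set as. a \<le> 2 ^ m) \<longrightarrow>
         \<bar>s (p # m # as) - wave (dyadic_point m as)\<bar> \<le> 1 / 2 ^ p)" by blast
  \<comment> \<open>The exponent \<open>i + i + c\<close> splits into three parts: \<open>K\<close>
    for the number of terms of the partial sum, \<open>2 + 2 * CARD('n)\<close> for their Lipschitz
    constant, and \<open>i + 1\<close> for half of the tolerance. The tails take the other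
    half.\<close>
  define c where "c = 4 * CARD('n) + 5"
  have "computable 1 (\<lambda>xs. xs ! 0 + xs ! 0 + c)" by (intro computable_intros) simp_all
  moreover have "\<bar>wave x - wave y\<bar> \<le> 1 / 2 ^ i" if xy: "norm (x - y) \<le> 1 / 2 ^ (i + i + c)" for i x y
  proof -
    define K where "K = i + 2 * CARD('n) + 2"
    define F where "F x = (\<Sum>k<K. ripple k x)" for x
    have "\<bar>F x - F y\<bar> \<le> (\<Sum>k<K. \<bar>ripple k x - ripple k y\<bar>)"
      unfolding F_def by (simp flip: sum_subtractf)
    also have "\<dots> \<le> (\<Sum>k<K. 3 * (real CARD('n))\<^sup>2 * norm (x - y))" by (intro sum_mono ripple_lipschitz)
    also have "\<dots> = real K * (3 * (real CARD('n))\<^sup>2 * norm (x - y))" by simp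
    also have "\<dots> \<le> 2 ^ K * ((4 * 2 ^ (2 * CARD('n))) * (1 / 2 ^ (i + i + c)))"
      using of_nat_less_two_power[of K, where 'a = real] dim2_le
      by (intro mult_mono xy) auto
    also have "\<dots> = 1 / 2 ^ (i + 1)" 
    proof -
      have "i + i + c = K + (2 + 2 * CARD('n)) + (i + 1)" by (simp add: K_def c_def)
      then show ?thesis by (simp only: power_add) simp
    qed
    finally have F: "\<bar>F x - F y\<bar> \<le> 1 / 2 ^ (i + 1)" .
    have "2 * (real CARD('n))\<^sup>2 / 2 ^ K \<le> 2 * 2 ^ (2 * CARD('n)) / 2 ^ K"
      using dim2_le by (intro divide_right_mono) auto
    also have "\<dots> = 1 / 2 ^ (i + 1)" by (simp add: K_def power_add)
    finally have "\<bar>(wave x - F x) - (wave y - F y)\<bar> \<le> 1 / 2 ^ (i + 1)"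
      using wave_tail[of x K] wave_tail[of y K] unfolding F_def by linarith
    then show ?thesis using F by simp
  qed
  ultimately show "\<exists>h. computable 1 h \<and>
      (\<forall>i. \<forall>x\<in>cube. \<forall>y\<in>cube. norm (x - y) \<le> 1 / 2 ^ h [i] \<longrightarrow> \<bar>wave x - wave y\<bar> \<le> 1 / 2 ^ i)"
    by (intro exI[of _ "\<lambda>xs. xs ! 0 + xs ! 0 + c"]) simp
qed

section \<open>Differentiability off the null set\<close>

lemma weight_differentiable:
  assumes "\<And>j. 2 ^ level k * x $ j \<noteq> real (corner k j)"
  shows "weight k differentiable (at x)"
proof -
  have sq: "((\<lambda>v::real. (max 0 v)\<^sup>2) has_real_derivative 2 * max 0 v) (at v)" for v
  proof (cases v "0 :: real" rule: linorder_cases)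
    case less
    have "((\<lambda>v. 0) has_real_derivative 2 * max 0 v) (at v)" using less by simp
    then show ?thesis
      by (rule has_field_derivative_transform_within_open[where S = "{..<0}"]) (use less in auto)
  next
    case equal
    have "((\<lambda>v::real. (max 0 v)\<^sup>2) has_derivative (\<lambda>_. 0)) (at 0)"
    proof (rule has_derivativeI_sandwich[of 1])
      show "((\<lambda>y::real. \<bar>y\<bar>) \<longlongrightarrow> 0) (at 0)" by (auto intro!: tendsto_eq_intros)
      show "norm ((max 0 y)\<^sup>2 - (max 0 0)\<^sup>2 - 0) / norm (y - 0) \<le> \<bar>y\<bar>" if "y \<noteq> 0" for y :: real
        using that by (auto simp: divide_simps power2_eq_square max_def)
    qed auto
    then show ?thesis using equal by (simp add: has_field_derivative_def mult_zero_left[abs_def])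
  next
    case greater
    have "((\<lambda>v. v\<^sup>2) has_real_derivative 2 * max 0 v) (at v)"
      using greater by (auto intro!: derivative_eq_intros)
    then show ?thesis
      by (rule has_field_derivative_transform_within_open[where S = "{0<..}"]) (use greater in auto)
  qed
  have ab: "(\<lambda>x. \<bar>2 ^ level k * x $ j - real (corner k j)\<bar>) differentiable (at x)" for j
  proof -
    have "(norm :: real \<Rightarrow> real) differentiable (at (2 ^ level k * x $ j - real (corner k j)))"
      using assms[of j] by (intro differentiable_norm_at) simp
    moreover have "(\<lambda>x. 2 ^ level k * x $ j - real (corner k j)) differentiable (at x)"
      by (intro differentiable_diff differentiable_mult differentiable_const
          bounded_linear_imp_differentiable bounded_linear_vec_nth)
    ultimately show ?thesis using differentiable_chain_at[of "\<lambda>x. 2 ^ level k * x $ j - real (corner k j)" x norm]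
      by (simp add: o_def)
  qed
  define v where "v x = real CARD('n) - (\<Sum>j\<in>UNIV - {i0}. \<bar>2 ^ level k * x $ j - real (corner k j)\<bar>)" for x :: "real ^ 'n"
  have "v differentiable (at x)"
    unfolding v_def by (intro differentiable_diff differentiable_const differentiable_sum ballI ab) simp_all
  moreover have "(\<lambda>v::real. (max 0 v)\<^sup>2) differentiable (at (v x))"
    using sq unfolding differentiable_def has_field_derivative_def by blast
  ultimately have "(\<lambda>v::real. (max 0 v)\<^sup>2) \<circ> v differentiable (at x)"
    by (rule differentiable_chain_at)
  then show ?thesis by (simp add: weight_def[abs_def] v_def[abs_def] o_def)
qed

lemma ripple_differentiable:
  assumes x: "\<And>j (N::int) q. x $ j \<noteq> of_int N / 2 ^ q"
  shows "ripple k differentiable (at x)"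
proof -
  have "2 ^ level k * x $ j \<noteq> real (corner k j)" for j
    using x[of j "int (corner k j)" "level k"] by (auto simp: field_simps)
  then have "weight k differentiable (at x)" by (rule weight_differentiable)
  moreover have "(\<lambda>x. cut_sawtooth (3 * k) (level k) (corner k i0) (x $ i0)) differentiable (at x)"
  proof -
    have "cut_sawtooth (3 * k) (level k) (corner k i0) differentiable (at (x $ i0))"
      using level_le[of k] by (intro cut_sawtooth_differentiable x) simp
    moreover have "(\<lambda>x. x $ i0) differentiable (at x)"
      by (intro bounded_linear_imp_differentiable bounded_linear_vec_nth)
    ultimately show ?thesis
      using differentiable_chain_at[of "\<lambda>x. x $ i0" x "cut_sawtooth (3 * k) (level k) (corner k i0)"]
      by (simp add: o_def)
  qed
  ultimately show ?thesis
    unfolding ripple_def[abs_def] by (cases "active k") (simp_all add: differentiable_mult)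
qed

text \<open>Where the ripple does not vanish, \<open>y\<close> is at least one cell width away from
  \<open>x\<close>, so \<open>1 \<le> 4 ^ k * (norm (y - x))\<^sup>2\<close>. A height of order
  \<open>1 / 8 ^ k\<close> pays for this factor and leaves the summable
  \<open>(1 / 2) ^ k\<close>.\<close>

lemma ripple_far:
  assumes "\<not> (active k \<and> near k x)"
  shows "\<bar>ripple k y\<bar> \<le> (real CARD('n))\<^sup>2 * (1 / 2) ^ k * (norm (y - x))\<^sup>2"
proof (cases "ripple k y = 0")
  case False
  then have act: "active k" and g: "cut_sawtooth (3 * k) (level k) (corner k i0) (y $ i0) \<noteq> 0"
    and w: "weight k y \<noteq> 0"
    by (auto simp: ripple_def split: if_splits)
  obtain j where j: "real radius < \<bar>2 ^ level k * x $ j - real (corner k j)\<bar>"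
    using assms act by (auto simp: near_def not_le)
  have "\<bar>2 ^ level k * y $ j - real (corner k j)\<bar> \<le> real CARD('n) + 2"
  proof (cases "j = i0")
    case True
    then show ?thesis using cut_sawtooth_support[OF g] by simp
  next
    case False
    then have "\<bar>2 ^ level k * y $ j - real (corner k j)\<bar> \<le>
        (\<Sum>j\<in>UNIV - {i0}. \<bar>2 ^ level k * y $ j - real (corner k j)\<bar>)"
      by (intro member_le_sum) auto
    also have "\<dots> \<le> real CARD('n)" using w by (auto simp: weight_def max_def split: if_splits)
    finally show ?thesis by simp
  qed
  then have "1 \<le> \<bar>2 ^ level k * y $ j - 2 ^ level k * x $ j\<bar>"
    using j unfolding radius_def by simp
  also have "\<dots> = 2 ^ level k * \<bar>(y - x) $ j\<bar>" by (simp add: abs_mult flip: right_diff_distrib)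
  also have "\<dots> \<le> 2 ^ k * norm (y - x)"
    by (intro mult_mono component_le_norm_cart power_increasing level_le) auto
  finally have "1 \<le> (2 ^ k * norm (y - x))\<^sup>2" by (simp add: one_le_power)
  moreover have four: "((2::real) ^ k)\<^sup>2 = 4 ^ k" by (simp add: power2_eq_square flip: power_mult_distrib)
  ultimately have "1 \<le> 4 ^ k * (norm (y - x))\<^sup>2"
    by (simp add: power_mult_distrib four)
  then have "(real CARD('n))\<^sup>2 / 8 ^ k * 1 \<le> (real CARD('n))\<^sup>2 / 8 ^ k * (4 ^ k * (norm (y - x))\<^sup>2)"
    by (intro mult_left_mono) auto
  also have "\<dots> = (real CARD('n))\<^sup>2 * (1 / 2) ^ k * (norm (y - x))\<^sup>2"
  proof -
    have "(8::real) ^ k = 4 ^ k * 2 ^ k" by (simp flip: power_mult_distrib)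
    then show ?thesis by (simp add: power_divide)
  qed
  finally show ?thesis using ripple_le[of k y] ripple_nonneg[of k y] by simp
qed simp

lemma wave_differentiable:
  assumes x: "\<And>j (N::int) q. x $ j \<noteq> of_int N / 2 ^ q" and "x \<notin> (\<Inter>i. boxes i)"
  shows "wave differentiable (at x)"
proof -
  obtain K where K: "\<And>k. active k \<and> near k x \<Longrightarrow> k < K"
    using finite_active_near[OF assms(2)] by (auto simp: finite_nat_set_iff_bounded)
  show ?thesis
    unfolding wave_def[abs_def]
  proof (rule suminf_differentiable[OF ripple_differentiable summable_ripple _ summable_half])
    show "\<bar>ripple k y\<bar> \<le> (real CARD('n))\<^sup>2 * (1 / 2) ^ k * (norm (y - x))\<^sup>2" if "K \<le> k" for k y
      using K that by (intro ripple_far) (auto simp: not_less[symmetric])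
  qed (use x in auto)
qed

section \<open>Failure of the partial derivative on the null set\<close>

lemma wave_second_difference:
  assumes z: "of_int N \<le> 2 ^ (3 * k) * z $ i0" "2 ^ (3 * k) * z $ i0 \<le> of_int N + 1"
    and act: "active k" and corner: "\<And>j. real (corner k j) \<le> 2 ^ level k * z $ j \<and> 2 ^ level k * z $ j \<le> real (corner k j) + 1"
  defines "P \<equiv> \<lambda>c. z + (c / 2 ^ (3 * k) - z $ i0) *\<^sub>R axis i0 1"
  shows "wave (P (of_int N)) + wave (P (of_int N + 1)) - 2 * wave (P (of_int N + 1 / 2)) \<le> - (1 / 2 ^ (3 * k))"
proof -
  define g where "g j y = (if active j then cut_sawtooth (3 * j) (level j) (corner j i0) y else 0)" for j y
  have Pi0: "P c $ i0 = c / 2 ^ (3 * k)" for c by (simp add: P_def)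
  have wP: "weight j (P c) = weight j z" for j c
    unfolding weight_def P_def by (intro arg_cong[where f = "\<lambda>v. (max 0 (_ - v))\<^sup>2"] sum.cong) (auto simp: axis_def)
  have rP: "ripple j (P c) = g j (c / 2 ^ (3 * k)) * weight j z" for j c
    by (simp add: ripple_def g_def wP Pi0)
  \<comment> \<open>All weights are constant on the line through \<open>z\<close>, so the second
    difference of the \<open>j\<close>-th ripple is \<open>D j * weight j z\<close>, with
    \<open>D j\<close> a second difference in one variable.\<close>
  define D where "D j = g j (of_int N / 2 ^ (3 * k)) + g j ((of_int N + 1) / 2 ^ (3 * k)) - 2 * g j ((of_int N + 1 / 2) / 2 ^ (3 * k))" for j
  have small: "D j = 0" if j: "j < k" for j
  proof -
    obtain s c where sc: "\<And>y. of_int N \<le> 2 ^ (3 * k) * y \<and> 2 ^ (3 * k) * y \<le> of_int N + 1 \<Longrightarrow>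
        cut_sawtooth (3 * j) (level j) (corner j i0) y = s * y + c"
      using cut_sawtooth_affine[of "level j" "3 * j" "3 * k" N "corner j i0"] level_le[of j] j by auto
    have "cut_sawtooth (3 * j) (level j) (corner j i0) (of_int N / 2 ^ (3 * k)) = s * (of_int N / 2 ^ (3 * k)) + c"
      "cut_sawtooth (3 * j) (level j) (corner j i0) ((of_int N + 1) / 2 ^ (3 * k)) = s * ((of_int N + 1) / 2 ^ (3 * k)) + c"
      "cut_sawtooth (3 * j) (level j) (corner j i0) ((of_int N + 1 / 2) / 2 ^ (3 * k)) = s * ((of_int N + 1 / 2) / 2 ^ (3 * k)) + c"
      by (intro sc; simp)+
    then show ?thesis by (simp add: D_def g_def add_divide_distrib algebra_simps)
  qed
  have big: "D j = 0" if "k < j" for j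
  proof -
    have "sawtooth (3 * j) (of_int N / 2 ^ (3 * k)) = 0"
      using that by (intro sawtooth_dyadic) simp
    moreover have "sawtooth (3 * j) ((of_int N + 1) / 2 ^ (3 * k)) = 0"
      using sawtooth_dyadic[of "3 * k" "3 * j" "N + 1"] that by simp
    \<comment> \<open>The midpoint is a grid point of level \<open>3 * k + 1\<close>, which is still
      at most \<open>3 * j\<close>.\<close>
    moreover have "(of_int N + 1 / 2) / 2 ^ (3 * k) = (of_int (2 * N + 1) / 2 ^ (3 * k + 1) :: real)"
      by (simp add: field_simps)
    then have "sawtooth (3 * j) ((of_int N + 1 / 2) / 2 ^ (3 * k)) = 0"
      using sawtooth_dyadic[of "3 * k + 1" "3 * j" "2 * N + 1"] that by simp
    ultimately show ?thesis by (simp add: D_def g_def cut_sawtooth_zero)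
  qed
  have mid: "D k = - (1 / 2 ^ (3 * k))"
  proof -
    have lev: "level k \<le> 3 * k" using level_le[of k] by simp
    \<comment> \<open>A period is no longer than a cell width, and the window extends the cell of
      \<open>z\<close> by one width on each side. So the cut-off does not affect the period around
      \<open>z\<close>.\<close>
    have in_window: "real (corner k i0) - 1 \<le> 2 ^ level k * (c / 2 ^ (3 * k))"
      "2 ^ level k * (c / 2 ^ (3 * k)) \<le> real (corner k i0) + 2" if "of_int N \<le> c" "c \<le> of_int N + 1" for c
    proof -
      have "\<bar>c - 2 ^ (3 * k) * z $ i0\<bar> \<le> 1" using that z by linarith
      then have "\<bar>c / 2 ^ (3 * k) - z $ i0\<bar> \<le> 1 / 2 ^ (3 * k)"
        by (simp add: abs_le_iff divide_simps mult.commute)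
      then have "2 ^ level k * \<bar>c / 2 ^ (3 * k) - z $ i0\<bar> \<le> 2 ^ (3 * k) * (1 / 2 ^ (3 * k))"
        using lev by (intro mult_mono power_increasing) auto
      then have "\<bar>2 ^ level k * (c / 2 ^ (3 * k)) - 2 ^ level k * z $ i0\<bar> \<le> 1"
        by (simp only: right_diff_distrib[symmetric] abs_mult) simp
      then show "real (corner k i0) - 1 \<le> 2 ^ level k * (c / 2 ^ (3 * k))"
        "2 ^ level k * (c / 2 ^ (3 * k)) \<le> real (corner k i0) + 2"
        using corner[of i0] by linarith+
    qed
    have cut: "g k (c / 2 ^ (3 * k)) = sawtooth (3 * k) (c / 2 ^ (3 * k))" if "of_int N \<le> c" "c \<le> of_int N + 1" for c
      unfolding g_def using act in_window[OF that] cut_sawtooth_inside[OF lev] by simp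
    show ?thesis
      using sawtooth_dyadic[of "3 * k" "3 * k" N] sawtooth_dyadic[of "3 * k" "3 * k" "N + 1"]
        sawtooth_mid[of "3 * k" N] unfolding D_def by (simp add: cut)
  qed
  \<comment> \<open>Each of the \<open>CARD('n) - 1\<close> other coordinates contributes at most 1
    on the cell; this explains the \<open>CARD('n)\<close> in \<open>weight\<close>.\<close>
  have "1 \<le> weight k z"
  proof -
    have "(\<Sum>j\<in>UNIV - {i0}. \<bar>2 ^ level k * z $ j - real (corner k j)\<bar>) \<le> (\<Sum>j\<in>UNIV - {i0}. 1)"
      using corner by (intro sum_mono) (auto simp: abs_le_iff algebra_simps)
    also have "\<dots> = real CARD('n) - 1" by (simp add: card_Diff_singleton of_nat_diff Suc_leI)
    finally have "1 \<le> max 0 (real CARD('n) - (\<Sum>j\<in>UNIV - {i0}. \<bar>2 ^ level k * z $ j - real (corner k j)\<bar>))"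
      by linarith
    then show ?thesis unfolding weight_def by (rule one_le_power)
  qed
  have "(\<lambda>j. D j * weight j z) sums
      (wave (P (of_int N)) + wave (P (of_int N + 1)) - 2 * wave (P (of_int N + 1 / 2)))"
  proof -
    have "(\<lambda>j. ripple j (P (of_int N)) + ripple j (P (of_int N + 1)) - 2 * ripple j (P (of_int N + 1 / 2))) sums
      (wave (P (of_int N)) + wave (P (of_int N + 1)) - 2 * wave (P (of_int N + 1 / 2)))"
      unfolding wave_def by (intro sums_add sums_diff sums_mult summable_sums summable_ripple)
    then show ?thesis unfolding rP D_def by (simp add: algebra_simps)
  qed
  moreover have "(\<lambda>j. D j * weight j z) sums (\<Sum>j\<in>{k}. D j * weight j z)"
    by (rule sums_finite) (use small big in \<open>auto simp: neq_iff\<close>)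
  ultimately have "wave (P (of_int N)) + wave (P (of_int N + 1)) - 2 * wave (P (of_int N + 1 / 2)) = D k * weight k z"
    using sums_unique2 by simp
  also have "\<dots> \<le> - (1 / 2 ^ (3 * k))"
    using \<open>1 \<le> weight k z\<close> unfolding mid by (simp add: divide_right_mono)
  finally show ?thesis .
qed

lemma wave_no_partial_deriv:
  assumes z: "z \<in> cube" "z \<in> (\<Inter>i. boxes i)"
  shows "\<not> has_partial_deriv wave i0 z"
proof
  assume "has_partial_deriv wave i0 z"
  then obtain E where E: "((\<lambda>t. wave (z + t *\<^sub>R axis i0 1)) has_real_derivative E)
        (at 0 within {t. z + t *\<^sub>R axis i0 1 \<in> cube})"
    unfolding has_partial_deriv_def by blast
  define \<phi> where "\<phi> t = wave (z + t *\<^sub>R axis i0 1)" for t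
  have z01: "0 \<le> z $ j" "z $ j \<le> 1" for j using z(1) by (auto simp: mem_box_cart)
  have cube: "z + t *\<^sub>R axis i0 1 \<in> cube" if "0 \<le> z $ i0 + t" "z $ i0 + t \<le> 1" for t
    using that z01 by (auto simp: mem_box_cart axis_def)
  have "(\<phi> has_derivative (\<lambda>t. E * t)) (at 0 within {t. z + t *\<^sub>R axis i0 1 \<in> cube})"
    using E unfolding has_field_derivative_def \<phi>_def .
  then have "\<forall>e>0. \<exists>d>0. \<forall>t\<in>{t. z + t *\<^sub>R axis i0 1 \<in> cube}. norm (t - 0) < d \<longrightarrow>
      norm (\<phi> t - \<phi> 0 - E * (t - 0)) \<le> e * norm (t - 0)"
    unfolding has_derivative_within_alt by blast
  \<comment> \<open>With this tolerance the errors at the two ends and twice the error at the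
    midpoint add up to half a period at most, while the second difference is at least a whole period
    in size.\<close>
  from this[rule_format, of "1 / 8"] obtain \<delta> where \<delta>: "0 < \<delta>" and approx: "\<And>t. z + t *\<^sub>R axis i0 1 \<in> cube \<Longrightarrow> \<bar>t\<bar> < \<delta> \<Longrightarrow>
      \<bar>\<phi> t - \<phi> 0 - E * t\<bar> \<le> 1 / 8 * \<bar>t\<bar>"
    by auto
  have "\<forall>\<^sub>F m in sequentially. 1 / 2 ^ m < \<delta>" by (rule eventually_div_power2[OF \<delta>])
  then obtain M where M: "\<And>m. M \<le> m \<Longrightarrow> 1 / 2 ^ m < \<delta>" unfolding eventually_sequentially by blast
  obtain k where k: "layer k = M" "active k"
    "\<And>j. real (corner k j) \<le> 2 ^ level k * z $ j \<and> 2 ^ level k * z $ j \<le> real (corner k j) + 1"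
    using ex_active[OF z(2) z01(1)] by blast
  \<comment> \<open>Prescribing the layer \<open>M\<close> forces a large code, hence a period
    shorter than \<delta>.\<close>
  have "M \<le> k" using k(1) digit_le[of 0 k] by (simp add: layer_def)
  define r where "r = 3 * k"
  have r: "1 / 2 ^ r < \<delta>" using M[of r] \<open>M \<le> k\<close> by (simp add: r_def)
  \<comment> \<open>The minimum matters for \<open>z $ i0 = 1\<close>: the period must lie in the
    cube, where the increments are allowed.\<close>
  define N where "N = min \<lfloor>2 ^ r * z $ i0\<rfloor> (2 ^ r - 1)"
  have "2 ^ r * z $ i0 \<le> 2 ^ r" using z01(2)[of i0] by simp
  then have N: "of_int N \<le> 2 ^ r * z $ i0" "2 ^ r * z $ i0 \<le> of_int N + 1"
  proof -
    have "N \<le> \<lfloor>2 ^ r * z $ i0\<rfloor>" by (simp add: N_def)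
    then show "of_int N \<le> 2 ^ r * z $ i0" by linarith
    show "2 ^ r * z $ i0 \<le> of_int N + 1"
    proof (cases "\<lfloor>2 ^ r * z $ i0\<rfloor> \<le> 2 ^ r - 1")
      case True
      then have "N = \<lfloor>2 ^ r * z $ i0\<rfloor>" by (simp add: N_def)
      then show ?thesis by linarith
    next
      case False
      then have "N = 2 ^ r - 1" by (simp add: N_def)
      then show ?thesis using \<open>2 ^ r * z $ i0 \<le> 2 ^ r\<close> by simp
    qed
  qed
  have "0 \<le> N" "N + 1 \<le> 2 ^ r" using z01(1)[of i0] by (auto simp: N_def)
  then have "real_of_int 0 \<le> of_int N" "real_of_int (N + 1) \<le> of_int (2 ^ r)" by (simp_all only: of_int_le_iff)
  then have N01: "0 \<le> real_of_int N" "of_int N + 1 \<le> (2 ^ r :: real)" by simp_all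
  define T where "T c = c / 2 ^ r - z $ i0" for c :: real
  have est: "\<bar>\<phi> (T c) - \<phi> 0 - E * T c\<bar> \<le> 1 / 8 * (1 / 2 ^ r)" if c: "of_int N \<le> c" "c \<le> of_int N + 1" for c
  proof -
    have "\<bar>c - 2 ^ r * z $ i0\<bar> \<le> 1" using that N by linarith
    then have *: "\<bar>T c\<bar> \<le> 1 / 2 ^ r" by (simp add: T_def abs_le_iff divide_simps mult.commute)
    have "0 \<le> z $ i0 + T c" "z $ i0 + T c \<le> 1" using c N01 by (auto simp: T_def divide_simps)
    then have "\<bar>\<phi> (T c) - \<phi> 0 - E * T c\<bar> \<le> 1 / 8 * \<bar>T c\<bar>"
      using * r by (intro approx cube) auto
    then show ?thesis using * by simp
  qed
  have "T (of_int N) + T (of_int N + 1) - 2 * T (of_int N + 1 / 2) = 0"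
    by (simp add: T_def field_simps)
  then have "E * T (of_int N) + E * T (of_int N + 1) - 2 * (E * T (of_int N + 1 / 2)) = 0"
    by (metis (no_types, opaque_lifting) distrib_left mult.left_commute mult_zero_right right_diff_distrib)
  moreover have "\<phi> (T (of_int N)) + \<phi> (T (of_int N + 1)) - 2 * \<phi> (T (of_int N + 1 / 2)) \<le> - (1 / 2 ^ r)"
    unfolding \<phi>_def T_def r_def
    by (rule wave_second_difference) (use N k in \<open>simp_all add: r_def\<close>)
  moreover have "0 < 1 / (2 ^ r :: real)" by simp
  ultimately show False
    using est[OF order_refl] est[OF _ order_refl] est[of "of_int N + 1 / 2"]
    unfolding abs_le_iff by linarith
qed

lemma ae_differentiable_wave:
  assumes "cube \<inter> (\<Inter>i. boxes i) \<in> null_sets lebesgue"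
  shows "ae_differentiable wave"
proof -
  \<comment> \<open>The kinks of all ripples lie on these countably many dyadic hyperplanes.\<close>
  define Q where "Q = (\<Union>j. \<Union>N::int. \<Union>q::nat. {x :: real ^ 'n. x $ j = of_int N / 2 ^ q})"
  have "negligible {x :: real ^ 'n. x $ j = c}" for j c
    by (simp add: cart_eq_inner_axis negligible_standard_hyperplane)
  then have "negligible Q"
    unfolding Q_def by (intro negligible_UN) (auto simp: countable_finite)
  then have "Q \<in> null_sets lebesgue" by (simp add: negligible_iff_null_sets)
  then have "Q \<union> (cube \<inter> (\<Inter>i. boxes i)) \<in> null_sets lebesgue" using assms by blast
  then have "AE x in lebesgue. x \<notin> Q \<union> (cube \<inter> (\<Inter>i. boxes i))" by (rule AE_not_in)
  then have "AE x in lebesgue. x \<in> cube \<longrightarrow> differentiable_in_cube wave x"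
  proof eventually_elim
    case (elim x)
    show ?case
    proof
      assume "x \<in> cube"
      then have "x \<notin> (\<Inter>i. boxes i)" using elim by blast
      moreover have "x $ j \<noteq> of_int N / 2 ^ q" for j and N :: int and q using elim unfolding Q_def by blast
      ultimately have "wave differentiable (at x)" using wave_differentiable by blast
      then show "differentiable_in_cube wave x"
        unfolding differentiable_in_cube_def by (rule differentiable_at_withinI)
    qed
  qed
  moreover have "cube \<inter> space lebesgue \<in> sets (lebesgue :: (real ^ 'n) measure)" by simp
  ultimately show ?thesis unfolding ae_differentiable_def by (simp add: AE_restrict_space_iff)
qed

end

section \<open>Effective openness of the sets of non-differentiability\<close>

lemma has_partial_deriv_if_differentiable:
  assumes "differentiable_in_cube f z"
  shows "has_partial_deriv f i z"
proof -
  obtain F where F: "(f has_derivative F) (at z within cube)"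
    using assms unfolding differentiable_in_cube_def differentiable_def by blast
  define T where "T = {t. z + t *\<^sub>R axis i 1 \<in> cube}"
  have g: "((\<lambda>t. z + t *\<^sub>R axis i 1) has_derivative (\<lambda>t. t *\<^sub>R axis i 1)) (at 0 within T)"
    by (auto intro!: derivative_eq_intros)
  have "(f has_derivative F) (at (z + 0 *\<^sub>R axis i 1) within (\<lambda>t. z + t *\<^sub>R axis i 1) ` T)"
  proof -
    have "(\<lambda>t. z + t *\<^sub>R axis i 1) ` T \<subseteq> cube" by (auto simp: T_def)
    from has_derivative_subset[OF F this] show ?thesis by simp
  qed
  from has_derivative_in_compose[OF g this]
  have "((\<lambda>t. f (z + t *\<^sub>R axis i 1)) has_derivative (\<lambda>t. F (t *\<^sub>R axis i 1))) (at 0 within T)" .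
  moreover have "(\<lambda>t. F (t *\<^sub>R axis i 1)) = (*) (F (axis i 1))"
    using linear_scale[OF has_derivative_linear[OF F]] by (intro ext) simp
  ultimately have "((\<lambda>t. f (z + t *\<^sub>R axis i 1)) has_derivative (*) (F (axis i 1))) (at 0 within T)"
    by (simp only:)
  then show ?thesis
    unfolding has_partial_deriv_def has_field_derivative_def T_def by (rule exI)
qed

text \<open>Unlike the Euclidean norm, this one is rational at rational vectors, so bounds on it can
  be decided exactly.\<close>

definition l1 :: "real ^ 'n \<Rightarrow> real" where
  "l1 v = (\<Sum>j\<in>UNIV. \<bar>v $ j\<bar>)"

definition slope_sum :: "('n \<Rightarrow> real) \<Rightarrow> real ^ 'n \<Rightarrow> real" where
  "slope_sum T v = (\<Sum>j\<in>UNIV. T j * v $ j)"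

lemma l1_triangle: "l1 (x + y) \<le> l1 x + l1 y"
  unfolding l1_def by (simp add: sum_mono abs_triangle_ineq flip: sum.distrib)

lemma l1_minus_commute: "l1 (x - y) = l1 (y - x)"
  by (simp add: l1_def abs_minus_commute)

lemma norm_le_l1: "norm v \<le> l1 v"
  unfolding l1_def by (rule norm_le_l1_cart)

lemma l1_le_norm: "l1 (v :: real ^ 'n) \<le> real CARD('n) * norm v"
  using sum_bounded_above[of UNIV "\<lambda>j. \<bar>v $ j\<bar>" "norm v"] by (simp add: l1_def component_le_norm_cart)

lemma slope_sum_diff: "slope_sum T (x - y) = slope_sum T x - slope_sum T y"
  by (simp add: slope_sum_def right_diff_distrib sum_subtractf)

lemma slope_sum_le:
  assumes "\<And>j. \<bar>T j - T' j\<bar> \<le> e"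
  shows "\<bar>slope_sum T v - slope_sum T' v\<bar> \<le> e * l1 v"
proof -
  have "slope_sum T v - slope_sum T' v = (\<Sum>j\<in>UNIV. (T j - T' j) * v $ j)"
    by (simp add: slope_sum_def left_diff_distrib sum_subtractf)
  also have "\<bar>\<dots>\<bar> \<le> (\<Sum>j\<in>UNIV. \<bar>T j - T' j\<bar> * \<bar>v $ j\<bar>)"
    by (rule order.trans[OF sum_abs]) (simp add: abs_mult)
  also have "\<dots> \<le> (\<Sum>j\<in>UNIV. e * \<bar>v $ j\<bar>)"
    using assms by (intro sum_mono mult_right_mono) auto
  finally show ?thesis by (simp add: l1_def sum_distrib_left)
qed

text \<open>At every point of the cube each coordinate direction admits increments of one sign, which
  makes the approximate slopes a Cauchy sequence.\<close>

lemma differentiable_in_cubeI: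
  fixes z :: "real ^ 'n"
  assumes z: "z \<in> cube"
    and "\<And>e. \<exists>T q. \<forall>y\<in>cube. l1 (y - z) < 1 / 2 ^ q \<longrightarrow>
      \<bar>f y - f z - slope_sum T (y - z)\<bar> \<le> 1 / 2 ^ e * l1 (y - z)"
  shows "differentiable_in_cube f z"
proof -
  obtain T q where Tq: "\<And>e y. y \<in> cube \<Longrightarrow> l1 (y - z) < 1 / 2 ^ q e \<Longrightarrow>
      \<bar>f y - f z - slope_sum (T e) (y - z)\<bar> \<le> 1 / 2 ^ e * l1 (y - z)"
    using assms(2) by metis
  have z01: "0 \<le> z $ j" "z $ j \<le> 1" for j using z by (auto simp: mem_box_cart)
  have close: "\<bar>T e j - T e' j\<bar> \<le> 1 / 2 ^ e + 1 / 2 ^ e'" for e e' j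
  proof -
    \<comment> \<open>The sign points to a face at distance at least 1/2, so the increment stays in
      the cube. Both slopes approximate the difference quotient of \<open>f\<close> along it, and
      the two tolerances add up.\<close>
    define \<sigma> :: real where "\<sigma> = (if z $ j \<le> 1 / 2 then 1 else -1)"
    define h :: real where "h = min (1 / 2) (min (1 / 2 ^ q e) (1 / 2 ^ q e') / 2)"
    have "0 < m \<and> m \<le> 1 / 2 \<and> m < A \<and> m < B" if "0 < A" "0 < B" "m = min (1 / 2) (min A B / 2)" for m A B :: real
      using that by (auto simp: min_def)
    from this[OF _ _ h_def] have h: "0 < h" "h \<le> 1 / 2" "h < 1 / 2 ^ q e" "h < 1 / 2 ^ q e'" by simp_all
    define v :: "real ^ 'n" where "v = axis j (\<sigma> * h)"
    have v: "z + v \<in> cube" "l1 v = h" "slope_sum S v = S j * (\<sigma> * h)" for S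
    proof -
      have "0 \<le> z $ j + \<sigma> * h" "z $ j + \<sigma> * h \<le> 1" using z01[of j] h by (auto simp: \<sigma>_def)
      then show "z + v \<in> cube" using z01 by (simp add: mem_box_cart v_def axis_def)
      show "l1 v = h" using h by (auto simp: l1_def v_def axis_def \<sigma>_def abs_mult if_distrib cong: if_cong)
      show "slope_sum S v = S j * (\<sigma> * h)"
        by (simp add: slope_sum_def v_def axis_def if_distrib cong: if_cong)
    qed
    have "\<bar>f (z + v) - f z - T e j * (\<sigma> * h)\<bar> \<le> 1 / 2 ^ e * h"
      "\<bar>f (z + v) - f z - T e' j * (\<sigma> * h)\<bar> \<le> 1 / 2 ^ e' * h"
      using Tq[of "z + v" e] Tq[of "z + v" e'] v h by simp_all
    then have "\<bar>T e j * (\<sigma> * h) - T e' j * (\<sigma> * h)\<bar> \<le> 1 / 2 ^ e * h + 1 / 2 ^ e' * h" by linarith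
    moreover have "\<bar>T e j * (\<sigma> * h) - T e' j * (\<sigma> * h)\<bar> = \<bar>T e j - T e' j\<bar> * h"
      using h by (simp add: abs_mult \<sigma>_def flip: left_diff_distrib)
    ultimately have "\<bar>T e j - T e' j\<bar> * h \<le> (1 / 2 ^ e + 1 / 2 ^ e') * h" by (simp only: distrib_right)
    then show ?thesis using h(1) by (rule mult_right_le_imp_le)
  qed
  have lim0: "(\<lambda>n. 1 / 2 ^ n :: real) \<longlonglongrightarrow> 0"
    using LIMSEQ_power_zero[of "1 / 2 :: real"] by (simp add: power_divide)
  have "\<exists>L. (\<lambda>e. T e j) \<longlonglongrightarrow> L" for j
  proof -
    have "Cauchy (\<lambda>e. T e j)"
    proof (rule CauchyI)
      fix \<epsilon> :: real assume "0 < \<epsilon>"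
      then have "\<forall>\<^sub>F n in sequentially. 2 / 2 ^ n < \<epsilon>" by (rule eventually_div_power2)
      then obtain M where M: "2 / 2 ^ M < \<epsilon>" unfolding eventually_sequentially by blast
      have "norm (T m j - T n j) < \<epsilon>" if "M \<le> m" "M \<le> n" for m n
      proof -
        have "1 / 2 ^ m \<le> 1 / (2::real) ^ M" "1 / 2 ^ n \<le> 1 / (2::real) ^ M"
          using that by (auto intro!: divide_left_mono power_increasing)
        then show ?thesis using close[of m j n] M by simp
      qed
      then show "\<exists>M. \<forall>m\<ge>M. \<forall>n\<ge>M. norm (T m j - T n j) < \<epsilon>" by blast
    qed
    then show ?thesis by (simp add: Cauchy_convergent_iff convergent_def)
  qed
  then obtain L where L: "\<And>j. (\<lambda>e. T e j) \<longlonglongrightarrow> L j" by metis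
  have TL: "\<bar>T e j - L j\<bar> \<le> 1 / 2 ^ e" for e j
  proof -
    have "(\<lambda>e'. \<bar>T e j - T e' j\<bar>) \<longlonglongrightarrow> \<bar>T e j - L j\<bar>" by (intro tendsto_intros L)
    moreover have "(\<lambda>e'. 1 / 2 ^ e + 1 / 2 ^ e' :: real) \<longlonglongrightarrow> 1 / 2 ^ e + 0" by (intro tendsto_intros lim0)
    ultimately show ?thesis using LIMSEQ_le close by fastforce
  qed
  have "(f has_derivative slope_sum L) (at z within cube)"
    unfolding has_derivative_within_alt
  proof (intro conjI allI impI)
    show "bounded_linear (slope_sum L)"
      unfolding slope_sum_def[abs_def]
      by (intro bounded_linear_sum bounded_linear_const_mult bounded_linear_vec_nth)
    fix \<epsilon> :: real assume "0 < \<epsilon>"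
    \<comment> \<open>One share of \<open>1 / 2 ^ e\<close> comes from the slopes
      \<open>T e\<close>, one from replacing them by their limit, and \<open>CARD('n)\<close> from
      passing to the Euclidean norm.\<close>
    then have "\<forall>\<^sub>F n in sequentially. (2 * real CARD('n)) / 2 ^ n < \<epsilon>" by (rule eventually_div_power2)
    then obtain e where e: "(2 * real CARD('n)) / 2 ^ e < \<epsilon>" unfolding eventually_sequentially by blast
    have "norm (f y - f z - slope_sum L (y - z)) \<le> \<epsilon> * norm (y - z)"
      if y: "y \<in> cube" "norm (y - z) < 1 / 2 ^ q e / real CARD('n)" for y
    proof -
      have "real CARD('n) * norm (y - z) < 1 / 2 ^ q e"
        using y(2) by (simp add: field_simps)
      then have "l1 (y - z) < 1 / 2 ^ q e"
        using l1_le_norm[of "y - z"] by linarith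
      then have "\<bar>f y - f z - slope_sum (T e) (y - z)\<bar> \<le> 1 / 2 ^ e * l1 (y - z)" using Tq y by blast
      moreover have "\<bar>slope_sum (T e) (y - z) - slope_sum L (y - z)\<bar> \<le> 1 / 2 ^ e * l1 (y - z)"
        by (rule slope_sum_le) (rule TL)
      ultimately have "\<bar>f y - f z - slope_sum L (y - z)\<bar> \<le> 2 / 2 ^ e * l1 (y - z)" by simp
      also have "\<dots> \<le> 2 / 2 ^ e * (real CARD('n) * norm (y - z))"
        by (intro mult_left_mono l1_le_norm) simp
      also have "\<dots> = (2 * real CARD('n)) / 2 ^ e * norm (y - z)" by simp
      also have "\<dots> \<le> \<epsilon> * norm (y - z)" using e by (intro mult_right_mono) auto
      finally show ?thesis by simp
    qed
    then show "\<exists>d>0. \<forall>y\<in>cube. norm (y - z) < d \<longrightarrow>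
        norm (f y - f z - slope_sum L (y - z)) \<le> \<epsilon> * norm (y - z)"
      by (intro exI[of _ "1 / 2 ^ q e / real CARD('n)"]) simp
  qed
  then show ?thesis unfolding differentiable_in_cube_def differentiable_def by blast
qed

text \<open>A code holds two scalars followed by two interleaved vectors. The same layout serves for
  slopes, where the vectors are subtracted, and for certificates, where they are two grid
  points.\<close>

definition left_digit :: "nat \<Rightarrow> 'n::finite \<Rightarrow> nat" where "left_digit k j = digit (2 * idx j + 2) k"
definition right_digit :: "nat \<Rightarrow> 'n::finite \<Rightarrow> nat" where "right_digit k j = digit (2 * idx j + 3) k"

lemma digits_surj: "\<exists>k. digit 0 k = p \<and> digit 1 k = w \<and> left_digit k = (a :: 'n::finite \<Rightarrow> nat) \<and> right_digit k = (b :: 'n \<Rightarrow> nat)"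
proof -
  let ?inv = "inv_into UNIV (idx :: 'n \<Rightarrow> nat)"
  define B where "B i = (if i = 0 then p else if i = 1 then w
      else if even i then a (?inv ((i - 2) div 2)) else b (?inv ((i - 3) div 2)))" for i
  obtain k where k: "\<And>j. j < 2 * CARD('n) + 2 \<Longrightarrow> digit j k = B j"
    using digit_surj[of "2 * CARD('n) + 2" B] by blast
  have inv: "?inv (idx j) = j" for j by (rule inv_into_f_f) (auto simp: inj_on_def idx_eq_iff)
  have "left_digit k j = a j" "right_digit k j = b j" for j
  proof -
    show "left_digit k j = a j"
      using k[of "2 * idx j + 2"] idx_less[of j] by (simp add: left_digit_def B_def inv)
    have "(2 * idx j + 3 - 3) div 2 = idx j" by simp
    then show "right_digit k j = b j"
      using k[of "2 * idx j + 3"] idx_less[of j] by (simp add: right_digit_def B_def inv)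
  qed
  then show ?thesis using k[of 0] k[of 1] by (intro exI[of _ k]) (simp add: B_def fun_eq_iff)
qed

text \<open>The difference of two naturals also yields negative slopes. Entry 0 is left for the
  radius, so one index runs through all pairs of a rational linear map and a neighbourhood.\<close>

definition slope :: "nat \<Rightarrow> 'n::finite \<Rightarrow> real" where
  "slope i j = (real (left_digit i j) - real (right_digit i j)) / 2 ^ digit 1 i"

lemma slope_dense:
  fixes F :: "'n::finite \<Rightarrow> real"
  assumes "0 < \<epsilon>"
  shows "\<exists>i. digit 0 i = q \<and> (\<forall>j. \<bar>slope i j - F j\<bar> \<le> \<epsilon>)"
proof -
  have "\<forall>\<^sub>F n in sequentially. 1 / 2 ^ n < \<epsilon>" using assms by (rule eventually_div_power2)
  then obtain w where w: "1 / 2 ^ w < \<epsilon>" unfolding eventually_sequentially by blast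
  obtain i where i: "digit 0 i = q" "digit 1 i = w"
    "left_digit i = (\<lambda>j. nat \<lfloor>2 ^ w * F j\<rfloor>)" "right_digit i = (\<lambda>j. nat (- \<lfloor>2 ^ w * F j\<rfloor>))"
    using digits_surj by blast
  have "\<bar>slope i j - F j\<bar> \<le> \<epsilon>" for j
  proof -
    have "real (nat N) - real (nat (- N)) = of_int N" for N :: int by (cases "0 \<le> N") auto
    then have "slope i j - F j = (of_int \<lfloor>2 ^ w * F j\<rfloor> - 2 ^ w * F j) / 2 ^ w"
      unfolding slope_def i by (simp add: diff_divide_distrib)
    also have "\<bar>\<dots>\<bar> \<le> 1 / 2 ^ w"
    proof -
      have "\<bar>of_int \<lfloor>2 ^ w * F j\<rfloor> - 2 ^ w * F j\<bar> \<le> 1" by linarith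
      then have "\<bar>of_int \<lfloor>2 ^ w * F j\<rfloor> - 2 ^ w * F j\<bar> / 2 ^ w \<le> 1 / 2 ^ w" by (rule divide_right_mono) simp
      then show ?thesis by (simp only: abs_divide abs_power2 power_abs abs_numeral)
    qed
    finally show ?thesis using w by simp
  qed
  then show ?thesis using i(1) by (intro exI[of _ i]) simp
qed

section \<open>Non-differentiability as an intersection of open conditions\<close>

locale cube_function =
  fixes f :: "real ^ 'n \<Rightarrow> real" and s :: "nat list \<Rightarrow> real" and h :: "nat list \<Rightarrow> nat"
  assumes s: "computable_rat (CARD('n) + 2) s" and h: "computable 1 h"
    and approx: "\<And>p m as. length as = CARD('n) \<Longrightarrow> \<forall>a\<in>set as. a \<le> 2 ^ m \<Longrightarrow>
      \<bar>s (p # m # as) - f (dyadic_point m as)\<bar> \<le> 1 / 2 ^ p"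
    and modulus: "\<And>i x y. x \<in> cube \<Longrightarrow> y \<in> cube \<Longrightarrow> norm (x - y) \<le> 1 / 2 ^ h [i] \<Longrightarrow>
      \<bar>f x - f y\<bar> \<le> 1 / 2 ^ i"
begin

text \<open>The strict inequality rules out \<open>y = x\<close>, where both sides are 0.\<close>

definition bad :: "nat \<Rightarrow> nat \<Rightarrow> (real ^ 'n) set" where
  "bad e i = {x \<in> cube. \<exists>y\<in>cube. l1 (y - x) < 1 / 2 ^ digit 0 i \<and>
     1 / 2 ^ e * l1 (y - x) < \<bar>f y - f x - slope_sum (slope i) (y - x)\<bar>}"

lemma not_bad_if_differentiable:
  assumes "differentiable_in_cube f x"
  shows "x \<notin> (\<Inter>i. bad e i)"
proof -
  obtain F where F: "(f has_derivative F) (at x within cube)"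
    using assms unfolding differentiable_in_cube_def differentiable_def by blast
  define T where "T j = F (axis j 1)" for j
  have FT: "F v = slope_sum T v" for v
  proof -
    have "F v = F (\<Sum>j\<in>UNIV. v $ j *\<^sub>R axis j 1)" using basis_expansion[of v] by (simp add: scalar_mult_eq_scaleR)
    also have "\<dots> = (\<Sum>j\<in>UNIV. v $ j * T j)"
      using has_derivative_linear[OF F] by (simp add: linear_sum linear_scale T_def)
    finally show ?thesis by (simp add: slope_sum_def mult.commute)
  qed
  \<comment> \<open>Half of the tolerance is for the derivative, half for replacing it by a rational
    linear map.\<close>
  define \<epsilon> :: real where "\<epsilon> = 1 / 2 ^ (e + 1)"
  have \<epsilon>: "0 < \<epsilon>" "\<epsilon> + \<epsilon> = 1 / 2 ^ e" by (simp_all add: \<epsilon>_def)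
  have "\<forall>\<epsilon>>0. \<exists>d>0. \<forall>y\<in>cube. norm (y - x) < d \<longrightarrow> norm (f y - f x - F (y - x)) \<le> \<epsilon> * norm (y - x)"
    using F unfolding has_derivative_within_alt by blast
  then obtain d where d: "0 < d" "\<And>y. y \<in> cube \<Longrightarrow> norm (y - x) < d \<Longrightarrow>
      \<bar>f y - f x - F (y - x)\<bar> \<le> \<epsilon> * norm (y - x)"
    using \<epsilon>(1) by (metis real_norm_def)
  have "\<forall>\<^sub>F n in sequentially. 1 / 2 ^ n < d" using d(1) by (rule eventually_div_power2)
  then obtain q where q: "1 / 2 ^ q < d" unfolding eventually_sequentially by blast
  obtain i where i: "digit 0 i = q" "\<And>j. \<bar>slope i j - T j\<bar> \<le> \<epsilon>"
    using slope_dense[OF \<epsilon>(1), of q T] by blast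
  have "\<bar>f y - f x - slope_sum (slope i) (y - x)\<bar> \<le> 1 / 2 ^ e * l1 (y - x)"
    if y: "y \<in> cube" "l1 (y - x) < 1 / 2 ^ q" for y
  proof -
    have "\<bar>f y - f x - slope_sum T (y - x)\<bar> \<le> \<epsilon> * norm (y - x)"
      using d(2)[OF y(1)] y(2) q norm_le_l1[of "y - x"] by (simp add: FT)
    also have "\<dots> \<le> \<epsilon> * l1 (y - x)" using \<epsilon>(1) by (intro mult_left_mono norm_le_l1) simp
    finally have "\<bar>f y - f x - slope_sum T (y - x)\<bar> \<le> \<epsilon> * l1 (y - x)" .
    moreover have "\<bar>slope_sum (slope i) (y - x) - slope_sum T (y - x)\<bar> \<le> \<epsilon> * l1 (y - x)"
      by (rule slope_sum_le) (rule i(2))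
    ultimately have "\<bar>f y - f x - slope_sum (slope i) (y - x)\<bar> \<le> \<epsilon> * l1 (y - x) + \<epsilon> * l1 (y - x)" by linarith
    also have "\<dots> = 1 / 2 ^ e * l1 (y - x)" by (simp only: \<epsilon>(2) flip: distrib_right)
    finally show ?thesis .
  qed
  then have "x \<notin> bad e i" unfolding bad_def i(1) by force
  then show ?thesis by blast
qed

lemma bad_if_not_differentiable:
  assumes "x \<in> cube" "\<not> differentiable_in_cube f x"
  shows "\<exists>e. x \<in> (\<Inter>i. bad e i)"
proof (rule ccontr)
  assume *: "\<not> (\<exists>e. x \<in> (\<Inter>i. bad e i))"
  have "\<exists>T q. \<forall>y\<in>cube. l1 (y - x) < 1 / 2 ^ q \<longrightarrow>
      \<bar>f y - f x - slope_sum T (y - x)\<bar> \<le> 1 / 2 ^ e * l1 (y - x)" for e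
  proof -
    obtain i where "x \<notin> bad e i" using * by blast
    then have "\<forall>y\<in>cube. \<not> (l1 (y - x) < 1 / 2 ^ digit 0 i \<and>
        1 / 2 ^ e * l1 (y - x) < \<bar>f y - f x - slope_sum (slope i) (y - x)\<bar>)"
      using assms(1) by (simp add: bad_def)
    then show ?thesis by (intro exI[of _ "slope i"] exI[of _ "digit 0 i"]) (meson not_less)
  qed
  then have "differentiable_in_cube f x" by (rule differentiable_in_cubeI[OF assms(1)])
  with assms(2) show False ..
qed

text \<open>A grid so fine that rounding moves both the point, in the l1 norm, and the value of
  \<open>f\<close> by at most \<open>1 / 2 ^ digit 0 k\<close>. The summand \<open>CARD('n)\<close>
  pays for adding up the errors of the coordinates.\<close>

definition scale :: "nat \<Rightarrow> nat" where
  "scale k = h [digit 0 k] + digit 0 k + CARD('n)"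

definition left_value :: "nat \<Rightarrow> real" where
  "left_value k = s (digit 0 k # scale k # map (\<lambda>n. digit (2 * n + 2) k) [0..<CARD('n)])"

definition right_value :: "nat \<Rightarrow> real" where
  "right_value k = s (digit 0 k # scale k # map (\<lambda>n. digit (2 * n + 3) k) [0..<CARD('n)])"

definition left_point :: "nat \<Rightarrow> real ^ 'n" where
  "left_point k = (\<chi> j. real (left_digit k j) / 2 ^ scale k)"

definition right_point :: "nat \<Rightarrow> real ^ 'n" where
  "right_point k = (\<chi> j. real (right_digit k j) / 2 ^ scale k)"

text \<open>The slack covers three errors in the values of \<open>f\<close> (two approximations and the oscillation
  of \<open>f\<close> near \<open>left_point k\<close>) and the oscillation of the linear term.\<close>

definition certified :: "nat \<Rightarrow> nat \<Rightarrow> nat \<Rightarrow> bool" where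
  "certified e i k \<longleftrightarrow> (\<forall>j\<in>UNIV. left_digit k (j::'n) \<le> 2 ^ scale k \<and> right_digit k j \<le> 2 ^ scale k) \<and>
     l1 (right_point k - left_point k) + 1 / 2 ^ digit 0 k < 1 / 2 ^ digit 0 i \<and>
     1 / 2 ^ e * (l1 (right_point k - left_point k) + 1 / 2 ^ digit 0 k) +
       (3 + (\<Sum>j\<in>UNIV. \<bar>slope i (j::'n)\<bar>)) * (1 / 2 ^ digit 0 k) <
     \<bar>right_value k - left_value k - slope_sum (slope i) (right_point k - left_point k)\<bar>"

lemma value_approx:
  assumes "\<And>j::'n. left_digit k j \<le> 2 ^ scale k \<and> right_digit k j \<le> 2 ^ scale k"
  shows "\<bar>left_value k - f (left_point k)\<bar> \<le> 1 / 2 ^ digit 0 k" "left_point k \<in> cube"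
    "\<bar>right_value k - f (right_point k)\<bar> \<le> 1 / 2 ^ digit 0 k" "right_point k \<in> cube"
proof -
  have le: "digit (2 * n + 2) k \<le> 2 ^ scale k" "digit (2 * n + 3) k \<le> 2 ^ scale k" if "n < CARD('n)" for n
    using idx_surj[OF that] assms unfolding left_digit_def right_digit_def by metis+
  have "left_point k = dyadic_point (scale k) (map (\<lambda>n. digit (2 * n + 2) k) [0..<CARD('n)])"
    by (simp add: left_point_def dyadic_point_def left_digit_def idx_less)
  then show "\<bar>left_value k - f (left_point k)\<bar> \<le> 1 / 2 ^ digit 0 k"
    unfolding left_value_def using le by (simp only:) (intro approx; auto)
  have "right_point k = dyadic_point (scale k) (map (\<lambda>n. digit (2 * n + 3) k) [0..<CARD('n)])"
    by (simp add: right_point_def dyadic_point_def right_digit_def idx_less)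
  then show "\<bar>right_value k - f (right_point k)\<bar> \<le> 1 / 2 ^ digit 0 k"
    unfolding right_value_def using le by (simp only:) (intro approx; auto)
  have "real (left_digit k j) \<le> 2 ^ scale k" "real (right_digit k j) \<le> 2 ^ scale k" for j :: 'n
    using assms[of j] by (simp_all flip: of_nat_le_iff)
  then show "left_point k \<in> cube" "right_point k \<in> cube"
    by (auto simp: mem_box_cart left_point_def right_point_def)
qed

lemma near_point:
  assumes x: "x \<in> cube" "y \<in> cube" and xy: "\<And>j. \<bar>x $ j - y $ j\<bar> \<le> 1 / 2 ^ scale k"
  shows "l1 (x - y) \<le> 1 / 2 ^ digit 0 k" "\<bar>f x - f y\<bar> \<le> 1 / 2 ^ digit 0 k"
    "\<bar>slope_sum T (x - y)\<bar> \<le> (\<Sum>j\<in>UNIV. \<bar>T j\<bar>) * (1 / 2 ^ digit 0 k)"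
proof -
  have "l1 (x - y) \<le> (\<Sum>j\<in>(UNIV::'n set). 1 / 2 ^ scale k)"
    unfolding l1_def using xy by (intro sum_mono) simp
  also have "\<dots> = real CARD('n) / 2 ^ scale k" by simp
  also have "\<dots> \<le> 2 ^ CARD('n) / 2 ^ scale k"
    using of_nat_less_two_power[of "CARD('n)", where 'a = real] by (intro divide_right_mono) auto
  also have "\<dots> = 1 / 2 ^ (h [digit 0 k] + digit 0 k)" by (simp add: scale_def power_add)
  finally have l1: "l1 (x - y) \<le> 1 / 2 ^ (h [digit 0 k] + digit 0 k)" .
  have mono: "1 / 2 ^ b \<le> 1 / (2::real) ^ a" if "a \<le> b" for a b
    using that by (intro divide_left_mono power_increasing) auto
  show "l1 (x - y) \<le> 1 / 2 ^ digit 0 k"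
    using l1 mono[of "digit 0 k" "h [digit 0 k] + digit 0 k"] by simp
  have "norm (x - y) \<le> 1 / 2 ^ h [digit 0 k]"
    using l1 mono[of "h [digit 0 k]" "h [digit 0 k] + digit 0 k"] norm_le_l1[of "x - y"] by simp
  then show "\<bar>f x - f y\<bar> \<le> 1 / 2 ^ digit 0 k" by (intro modulus x)
  have "\<bar>slope_sum T (x - y)\<bar> \<le> (\<Sum>j\<in>UNIV. \<bar>T j\<bar> * \<bar>(x - y) $ j\<bar>)"
    unfolding slope_sum_def by (rule order.trans[OF sum_abs]) (simp add: abs_mult)
  also have "\<dots> \<le> (\<Sum>j\<in>UNIV. \<bar>T j\<bar> * (1 / 2 ^ digit 0 k))"
  proof (intro sum_mono mult_left_mono)
    show "\<bar>(x - y) $ j\<bar> \<le> 1 / 2 ^ digit 0 k" for j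
      using xy[of j] mono[of "digit 0 k" "scale k"] by (simp add: scale_def)
  qed simp
  finally show "\<bar>slope_sum T (x - y)\<bar> \<le> (\<Sum>j\<in>UNIV. \<bar>T j\<bar>) * (1 / 2 ^ digit 0 k)"
    by (simp only: sum_distrib_right)
qed

text \<open>The witness for \<open>bad\<close> is \<open>right_point k\<close>;
  \<open>left_point k\<close> stands in for the nearby \<open>x\<close>.\<close>

lemma bad_if_certified:
  assumes cert: "certified e i k" and x: "x \<in> cube" "\<And>j. \<bar>x $ j - left_point k $ j\<bar> < 1 / 2 ^ scale k"
  shows "x \<in> bad e i"
proof -
  let ?p = "1 / 2 ^ digit 0 k :: real" and ?\<tau> = "\<Sum>j\<in>UNIV. \<bar>slope i (j::'n)\<bar>"
  have v: "\<bar>left_value k - f (left_point k)\<bar> \<le> ?p" "left_point k \<in> cube"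
    "\<bar>right_value k - f (right_point k)\<bar> \<le> ?p" "right_point k \<in> cube"
    using cert by (intro value_approx; auto simp: certified_def)+
  have near: "l1 (x - left_point k) \<le> ?p" "\<bar>f x - f (left_point k)\<bar> \<le> ?p"
    "\<bar>slope_sum (slope i) (x - left_point k)\<bar> \<le> ?\<tau> * ?p"
    by (intro near_point x v less_imp_le)+
  have "l1 (right_point k - x) \<le> l1 (right_point k - left_point k) + l1 (left_point k - x)"
    using l1_triangle[of "right_point k - left_point k" "left_point k - x"] by simp
  then have l1: "l1 (right_point k - x) \<le> l1 (right_point k - left_point k) + ?p"
    using near(1) by (simp add: l1_minus_commute)
  have "1 / 2 ^ e * l1 (right_point k - x) \<le> 1 / 2 ^ e * (l1 (right_point k - left_point k) + ?p)"
    using l1 by (intro mult_left_mono) auto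
  moreover have "slope_sum (slope i) (right_point k - x) =
      slope_sum (slope i) (right_point k - left_point k) - slope_sum (slope i) (x - left_point k)"
    by (simp add: slope_sum_diff)
  moreover have "(3 + ?\<tau>) * ?p = 3 * ?p + ?\<tau> * ?p" by (simp only: distrib_right)
  ultimately have "1 / 2 ^ e * l1 (right_point k - x) <
      \<bar>f (right_point k) - f x - slope_sum (slope i) (right_point k - x)\<bar>"
    using cert v near unfolding certified_def by linarith
  moreover have "l1 (right_point k - x) < 1 / 2 ^ digit 0 i"
    using cert l1 unfolding certified_def by linarith
  ultimately show ?thesis unfolding bad_def using x(1) v(4) by blast
qed

lemma certified_if_bad:
  assumes "x \<in> bad e i"
  shows "\<exists>k. certified e i k \<and> (\<forall>j. \<bar>x $ j - left_point k $ j\<bar> < 1 / 2 ^ scale k)"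
proof -
  let ?\<tau> = "\<Sum>j\<in>UNIV. \<bar>slope i (j::'n)\<bar>"
  obtain y where xy: "x \<in> cube" "y \<in> cube" and y: "l1 (y - x) < 1 / 2 ^ digit 0 i"
    "1 / 2 ^ e * l1 (y - x) < \<bar>f y - f x - slope_sum (slope i) (y - x)\<bar>"
    using assms unfolding bad_def by blast
  \<comment> \<open>The 3 counts the rounding of \<open>x\<close>, the rounding of \<open>y\<close>
    and the margin in \<open>certified\<close>. The 10 consists of 3 for these distances, 3 for the
    slack in \<open>certified\<close> and 4 for errors in values of \<open>f\<close>; the 3 in front
    of the slopes is one share of the slack and two roundings.\<close>
  have "\<forall>\<^sub>F p in sequentially. 3 / 2 ^ p < 1 / 2 ^ digit 0 i - l1 (y - x) \<and>
      (10 + 3 * ?\<tau>) / 2 ^ p < \<bar>f y - f x - slope_sum (slope i) (y - x)\<bar> - 1 / 2 ^ e * l1 (y - x)"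
    using y by (intro eventually_conj eventually_div_power2) simp_all
  then obtain p where p: "3 / 2 ^ p < 1 / 2 ^ digit 0 i - l1 (y - x)"
      "(10 + 3 * ?\<tau>) / 2 ^ p < \<bar>f y - f x - slope_sum (slope i) (y - x)\<bar> - 1 / 2 ^ e * l1 (y - x)"
    unfolding eventually_sequentially by blast
  \<comment> \<open>The scale depends on the code through \<open>digit 0\<close> only, so the grid
    can be fixed before the code that contains the rounded points.\<close>
  define M where "M = h [p] + p + CARD('n)"
  obtain k where k: "digit 0 k = p" "left_digit k = (\<lambda>j. nat \<lfloor>2 ^ M * x $ j\<rfloor>)" "right_digit k = (\<lambda>j. nat \<lfloor>2 ^ M * y $ j\<rfloor>)"
    using digits_surj by blast
  have M: "scale k = M" by (simp add: scale_def M_def k)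
  define P :: real where "P = 1 / 2 ^ p"
  have P: "1 / 2 ^ digit 0 k = P" by (simp add: P_def k)
  have p': "3 * P < 1 / 2 ^ digit 0 i - l1 (y - x)"
    "10 * P + 3 * (?\<tau> * P) < \<bar>f y - f x - slope_sum (slope i) (y - x)\<bar> - 1 / 2 ^ e * l1 (y - x)"
    using p by (simp_all add: P_def add_divide_distrib)
  have grid: "nat \<lfloor>2 ^ M * t\<rfloor> \<le> 2 ^ M" "\<bar>t - real (nat \<lfloor>2 ^ M * t\<rfloor>) / 2 ^ M\<bar> < 1 / 2 ^ M"
    if "0 \<le> t" "t \<le> 1" for t :: real
  proof -
    have "\<lfloor>2 ^ M * t\<rfloor> \<le> \<lfloor>(2::real) ^ M\<rfloor>" using that by (intro floor_mono) (simp add: mult_left_le)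
    also have "\<lfloor>(2::real) ^ M\<rfloor> = 2 ^ M" by (metis floor_of_int of_int_numeral of_int_power)
    finally show "nat \<lfloor>2 ^ M * t\<rfloor> \<le> 2 ^ M" by (simp add: nat_le_iff)
    have "\<bar>2 ^ M * t - real (nat \<lfloor>2 ^ M * t\<rfloor>)\<bar> < 1" using that by simp linarith
    then have "\<bar>2 ^ M * t - real (nat \<lfloor>2 ^ M * t\<rfloor>)\<bar> / 2 ^ M < 1 / 2 ^ M" by (intro divide_strict_right_mono) auto
    moreover have "(2 ^ M * t - real (nat \<lfloor>2 ^ M * t\<rfloor>)) / 2 ^ M = t - real (nat \<lfloor>2 ^ M * t\<rfloor>) / 2 ^ M"
      by (simp add: diff_divide_distrib)
    ultimately show "\<bar>t - real (nat \<lfloor>2 ^ M * t\<rfloor>) / 2 ^ M\<bar> < 1 / 2 ^ M" by (metis abs_divide abs_numeral power_abs)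
  qed
  have xy01: "0 \<le> x $ j" "x $ j \<le> 1" "0 \<le> y $ j" "y $ j \<le> 1" for j
    using xy by (auto simp: mem_box_cart)
  have dig: "left_digit k j \<le> 2 ^ scale k \<and> right_digit k j \<le> 2 ^ scale k" for j :: 'n
    using grid(1) xy01 by (simp add: k M)
  have xl: "\<bar>x $ j - left_point k $ j\<bar> < 1 / 2 ^ scale k" and yr: "\<bar>y $ j - right_point k $ j\<bar> < 1 / 2 ^ scale k" for j
    using grid(2) xy01 by (simp_all add: left_point_def right_point_def k M)
  have v: "\<bar>left_value k - f (left_point k)\<bar> \<le> P" "left_point k \<in> cube"
    "\<bar>right_value k - f (right_point k)\<bar> \<le> P" "right_point k \<in> cube"
    using value_approx[OF dig] unfolding P by blast+
  have near: "l1 (x - left_point k) \<le> P" "\<bar>f x - f (left_point k)\<bar> \<le> P"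
    "\<bar>slope_sum (slope i) (x - left_point k)\<bar> \<le> ?\<tau> * P"
    "l1 (y - right_point k) \<le> P" "\<bar>f y - f (right_point k)\<bar> \<le> P"
    "\<bar>slope_sum (slope i) (y - right_point k)\<bar> \<le> ?\<tau> * P"
    unfolding P[symmetric] by (intro near_point xy v less_imp_le xl yr)+
  have "l1 (right_point k - left_point k) \<le> l1 (right_point k - y) + (l1 (y - x) + l1 (x - left_point k))"
    using l1_triangle[of "right_point k - y" "y - left_point k"] l1_triangle[of "y - x" "x - left_point k"] by simp
  then have l1: "l1 (right_point k - left_point k) \<le> l1 (y - x) + 2 * P"
    using near(1,4) l1_minus_commute[of y "right_point k"] by linarith
  have sl: "slope_sum (slope i) (y - x) = slope_sum (slope i) (y - right_point k) +
      slope_sum (slope i) (right_point k - left_point k) - slope_sum (slope i) (x - left_point k)"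
    by (simp add: slope_sum_diff)
  have "1 / 2 ^ e * (l1 (right_point k - left_point k) + P) \<le> 1 / 2 ^ e * (l1 (y - x) + 3 * P)"
    using l1 by (intro mult_left_mono) auto
  also have "\<dots> = 1 / 2 ^ e * l1 (y - x) + 1 / 2 ^ e * (3 * P)" by (rule distrib_left)
  also have "1 / 2 ^ e * (3 * P) \<le> 1 * (3 * P)" by (intro mult_right_mono) (auto simp: P_def)
  finally have e: "1 / 2 ^ e * (l1 (right_point k - left_point k) + P) \<le> 1 / 2 ^ e * l1 (y - x) + 3 * P" by simp
  have "(3 + ?\<tau>) * P = 3 * P + ?\<tau> * P" by (rule distrib_right)
  then have "1 / 2 ^ e * (l1 (right_point k - left_point k) + P) + (3 + ?\<tau>) * P <
     \<bar>right_value k - left_value k - slope_sum (slope i) (right_point k - left_point k)\<bar>"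
    using p'(2) v near sl e by linarith
  moreover have "l1 (right_point k - left_point k) + P < 1 / 2 ^ digit 0 i"
    using l1 p'(1) by linarith
  ultimately have "certified e i k"
    unfolding certified_def P using dig by blast
  then show ?thesis using xl by blast
qed

section \<open>Effective enumeration of the bad sets\<close>

lemma decidable_certified:
  "decidable 3 (\<lambda>xs. certified e (xs ! 0) (xs ! 1))"
proof -
  have dig: "computable 3 (\<lambda>xs. digit c (xs ! 0))" "computable 3 (\<lambda>xs. digit c (xs ! 1))" for c
    by (intro computable_digit computable_nth computable_const; simp)+
  have h': "computable 3 (\<lambda>xs. h [digit 0 (xs ! 1)])"
    using computable_comp[OF h, of "[\<lambda>xs. digit 0 (xs ! 1)]" 3] dig by simp
  have sc: "computable 3 (\<lambda>xs. scale (xs ! 1))"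
    unfolding scale_def by (intro computable_add h' dig computable_const)
  have val: "computable_rat 3 (\<lambda>xs. s (digit 0 (xs ! 1) # scale (xs ! 1) # map (\<lambda>n. digit (2 * n + c) (xs ! 1)) [0..<CARD('n)]))" for c
  proof -
    have "computable_rat 3 (\<lambda>xs. s (map (\<lambda>g. g xs) ((\<lambda>xs. digit 0 (xs ! 1)) # (\<lambda>xs. scale (xs ! 1)) #
        map (\<lambda>n xs. digit (2 * n + c) (xs ! 1)) [0..<CARD('n)])))"
      by (rule computable_rat_comp[OF s]) (use dig sc in auto)
    then show ?thesis by (simp add: o_def)
  qed
  have half: "computable_rat 3 (\<lambda>xs. 1 / 2 ^ e)"
    by (intro computable_rat_intros computable_const)
  show ?thesis
    unfolding certified_def l1_def slope_sum_def slope_def left_value_def right_value_def left_point_def right_point_def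
      left_digit_def right_digit_def vector_minus_component vec_lambda_beta
    by (intro decidable_conj decidable_Ball_finite decidable_le computable_power computable_rat_intros
        computable_rat_sum_finite half val sc dig computable_const finite)
qed

lemma uniformly_effectively_open_bad: "uniformly_effectively_open (bad e)"
proof -
  \<comment> \<open>A certified code yields the open cube of one grid width around
    \<open>left_point\<close>; any other code yields equal corners, hence the empty box.\<close>
  define l where "l xs = (if certified e (xs ! 0) (xs ! 1)
     then (real (digit (2 * (xs ! 2) + 2) (xs ! 1)) - 1) / 2 ^ scale (xs ! 1) else 0)" for xs
  define u where "u xs = (if certified e (xs ! 0) (xs ! 1)
     then (real (digit (2 * (xs ! 2) + 2) (xs ! 1)) + 1) / 2 ^ scale (xs ! 1) else 0)" for xs
  have dig: "computable 3 (\<lambda>xs. digit (2 * (xs ! 2) + 2) (xs ! 1))" "computable 3 (\<lambda>xs. digit 0 (xs ! 1))"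
    by (intro computable_digit computable_intros; simp)+
  have h': "computable 3 (\<lambda>xs. h [digit 0 (xs ! 1)])"
    using computable_comp[OF h, of "[\<lambda>xs. digit 0 (xs ! 1)]" 3] dig by simp
  have sc: "computable 3 (\<lambda>xs. scale (xs ! 1))"
    unfolding scale_def by (intro computable_add h' dig computable_const)
  have "computable_rat 3 l" "computable_rat 3 u"
    unfolding l_def u_def by (intro computable_rat_intros decidable_certified dig sc)+
  moreover have "bad e i = cube \<inter> (\<Union>k. box (\<chi> j. l [i, k, idx j]) (\<chi> j. u [i, k, idx j]))" for i
  proof -
    have box: "x \<in> box (\<chi> j. l [i, k, idx j]) (\<chi> j. u [i, k, idx j]) \<longleftrightarrow>
        certified e i k \<and> (\<forall>j. \<bar>x $ j - left_point k $ j\<bar> < 1 / 2 ^ scale k)" for x :: "real ^ 'n" and k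
    proof (cases "certified e i k")
      case True
      have "(real a - 1) / 2 ^ M < t \<and> t < (real a + 1) / 2 ^ M \<longleftrightarrow> \<bar>t - real a / 2 ^ M\<bar> < 1 / 2 ^ M" for a M t
        by (auto simp: diff_divide_distrib add_divide_distrib abs_less_iff)
      then show ?thesis using True by (simp add: mem_box_cart l_def u_def left_point_def left_digit_def)
    next
      case False
      then show ?thesis by (auto simp: mem_box_cart l_def u_def)
    qed
    show ?thesis
    proof (intro equalityI subsetI)
      fix x :: "real ^ 'n" assume x: "x \<in> bad e i"
      then have "x \<in> cube" by (simp add: bad_def)
      then show "x \<in> cube \<inter> (\<Union>k. box (\<chi> j. l [i, k, idx j]) (\<chi> j. u [i, k, idx j]))"
        using certified_if_bad[OF x] unfolding Int_iff UN_iff box by simp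
    next
      fix x :: "real ^ 'n" assume "x \<in> cube \<inter> (\<Union>k. box (\<chi> j. l [i, k, idx j]) (\<chi> j. u [i, k, idx j]))"
      then obtain k where "x \<in> cube" "certified e i k" "\<And>j. \<bar>x $ j - left_point k $ j\<bar> < 1 / 2 ^ scale k"
        unfolding Int_iff UN_iff box by blast
      then show "x \<in> bad e i" by (intro bad_if_certified)
    qed
  qed
  ultimately show ?thesis
    unfolding uniformly_effectively_open_def by (intro exI[of _ l] exI[of _ u] conjI allI)
qed

lemma differentiable_if_weakly_2_random:
  assumes "ae_differentiable f" "z \<in> cube" "weakly_2_random z"
  shows "differentiable_in_cube f z"
proof (rule ccontr)
  assume "\<not> differentiable_in_cube f z"
  then obtain e where z: "z \<in> (\<Inter>i. bad e i)" using bad_if_not_differentiable assms(2) by blast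
  have "AE x in lebesgue. x \<in> cube \<longrightarrow> differentiable_in_cube f x"
    using assms(1) unfolding ae_differentiable_def by (subst (asm) AE_restrict_space_iff) auto
  then obtain N where N: "N \<in> null_sets lebesgue" "{x. \<not> (x \<in> cube \<longrightarrow> differentiable_in_cube f x)} \<subseteq> N"
    unfolding eventually_ae_filter by auto
  have "(\<Inter>i. bad e i) \<subseteq> N"
    using N(2) not_bad_if_differentiable unfolding bad_def by fastforce
  \<comment> \<open>Completeness of Lebesgue measure gives measurability as well.\<close>
  then have "(\<Inter>i. bad e i) \<in> null_sets lebesgue"
    using N(1) null_sets_completion_subset by blast
  moreover have "Pi02 (\<Inter>i. bad e i)"
    unfolding Pi02_def using uniformly_effectively_open_bad by blast
  ultimately show False using z assms(3) unfolding weakly_2_random_def by blast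
qed

end

section \<open>The equivalence\<close>

lemma ex_not_has_partial_deriv:
  fixes z :: "real ^ 'n"
  assumes "z \<in> cube" "\<not> weakly_2_random z"
  shows "\<exists>f. computable_on_cube f \<and> ae_differentiable f \<and> \<not> has_partial_deriv f i z"
proof -
  obtain A where A: "Pi02 A" "A \<in> null_sets lebesgue" "z \<in> A"
    using assms(2) unfolding weakly_2_random_def by blast
  obtain G where G: "uniformly_effectively_open G" "A = (\<Inter>i. G i)"
    using A(1) unfolding Pi02_def by blast
  obtain l u where lu: "computable_rat 3 l" "computable_rat 3 u"
    "\<And>i. G i = cube \<inter> (\<Union>k. box (\<chi> j. l [i, k, idx j]) (\<chi> j. u [i, k, idx j]))"
    using G(1) unfolding uniformly_effectively_open_def by blast
  interpret Pi02_code l u i by unfold_locales (rule lu)+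
  have "A = cube \<inter> (\<Inter>i. boxes i)"
    unfolding G(2) lu(3) boxes_def by blast
  then show ?thesis
    using A(2,3) assms(1) computable_on_cube_wave ae_differentiable_wave wave_no_partial_deriv
    by (intro exI[of _ wave]) auto
qed

lemma differentiable_in_cube_if_weakly_2_random:
  fixes z :: "real ^ 'n"
  assumes f: "computable_on_cube f" and "ae_differentiable f" "z \<in> cube" "weakly_2_random z"
  shows "differentiable_in_cube f z"
proof -
  obtain s where s: "computable_rat (CARD('n) + 2) s"
    "\<And>p m as. length as = CARD('n) \<Longrightarrow> \<forall>a\<in>set as. a \<le> 2 ^ m \<Longrightarrow>
      \<bar>s (p # m # as) - f (dyadic_point m as)\<bar> \<le> 1 / 2 ^ p"
    using f unfolding computable_on_cube_def by blast
  obtain h where h: "computable 1 h"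
    "\<And>i x y. x \<in> cube \<Longrightarrow> y \<in> cube \<Longrightarrow> norm (x - y) \<le> 1 / 2 ^ h [i] \<Longrightarrow> \<bar>f x - f y\<bar> \<le> 1 / 2 ^ i"
    using f unfolding computable_on_cube_def by blast
  interpret cube_function f s h using s h by unfold_locales
  show ?thesis using assms(2-4) by (rule differentiable_if_weakly_2_random)
qed

theorem theorem3p2:
  fixes z :: "real ^ 'n"
  assumes "z \<in> cube"
  shows "(weakly_2_random z \<longleftrightarrow>
            (\<forall>f. computable_on_cube f \<and> ae_differentiable f \<longrightarrow> (\<forall>i. has_partial_deriv f i z))) \<and>
         (weakly_2_random z \<longleftrightarrow>
            (\<forall>f. computable_on_cube f \<and> ae_differentiable f \<longrightarrow> differentiable_in_cube f z))"
proof -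
  have 1: "differentiable_in_cube f z" if "weakly_2_random z" "computable_on_cube f \<and> ae_differentiable f" for f
    using that assms differentiable_in_cube_if_weakly_2_random by blast
  have 2: "\<exists>f i. computable_on_cube f \<and> ae_differentiable f \<and> \<not> has_partial_deriv f i z"
    if "\<not> weakly_2_random z"
    \<comment> \<open>\<open>undefined\<close> stands for an arbitrary coordinate; the construction
      works in every direction.\<close>
    using ex_not_has_partial_deriv[OF assms that, of undefined] by blast
  show ?thesis
    using 1 2 has_partial_deriv_if_differentiable by blast
qed

end
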